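(* Let $K$ be a number field (a finite extension of $\mathbb{Q}$) and let $C\subseteq\omega$ be a cohesive set. Then the group $\mathrm{Aut}(\prod_C K/\prod_C\mathbb{Q})$ is isomorphic to $\mathrm{Aut}(K/\mathbb{Q})$.
   Context: For $A,B\subseteq\omega$, $A\subseteq^* B$ means $A\setminus B$ is finite. A set $C\subseteq\omega$ is cohesive if it is infinite and for every c.e. set $W$ either $C\subseteq^*W$ or $C\subseteq^*\overline{W}$. A computable structure has computable domain $\subseteq\omega$ and computable atomic diagram. For a computable structure $\mathcal A$ and cohesive $C$, the cohesive power $\prod_C\mathcal A$ has as domain the classes $[\varphi]$ of partial computable functions $\varphi$ from $\omega$ to $\mathcal{A}$ with $C\subseteq^*\mathrm{dom}(\varphi)$, where $[\varphi]=[\psi]$ iff $C\subseteq^*\{i:\varphi(i){\downarrow}=\psi(i){\downarrow}\}$; functions and constants are interpreted pointwise, and a relation $R$ holds of $[\varphi_0],\dots,[\varphi_{m-1}]$ iff $C\subseteq^*\{i: R^{\mathcal A}(\varphi_0(i),\dots,\varphi_{m-1}(i))\}$. $K$ is given a computable presentation as a field; $\prod_C\mathbb{Q}$ is regarded as the subfield of $\prod_CK$ of classes of partial computable functions with values in $\mathbb{Q}\subseteq K$. $\mathrm{Aut}(L/E)$ is the group of field automorphisms of $L$ fixing $E$ pointwise. *)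

theory Defs
  imports
    "HOL-Library.Nat_Bijection"
    "HOL-Algebra.Algebra"
begin

section \<open>Partial computable functions\<close>

text \<open>
  \<open>partial_recursive n f\<close>: the restriction of \<open>f\<close> to lists of length \<open>n\<close> is an \<open>n\<close>-ary partial
  recursive function. Values of \<open>f\<close> on lists of any other length are irrelevant (rule \<open>ext\<close>), so
  the other rules do not constrain the length of the argument list.
\<close>

inductive partial_recursive :: "nat \<Rightarrow> (nat list \<Rightarrow> nat option) \<Rightarrow> bool" where
  zero: "partial_recursive n (\<lambda>_. Some 0)"
| succ: "partial_recursive 1 (\<lambda>xs. Some (Suc (hd xs)))"
| proj: "i < n \<Longrightarrow> partial_recursive n (\<lambda>xs. Some (xs ! i))"
| comp: "partial_recursive (length gs) f \<Longrightarrow> \<forall>g\<in>set gs. partial_recursive n g \<Longrightarrow>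
    partial_recursive n (\<lambda>xs. Option.bind (those (map (\<lambda>g. g xs) gs)) f)"
| prim_rec: "partial_recursive n f \<Longrightarrow> partial_recursive (Suc (Suc n)) g \<Longrightarrow>
    partial_recursive (Suc n)
      (\<lambda>xs. rec_nat (f (tl xs)) (\<lambda>k r. Option.bind r (\<lambda>v. g (k # v # tl xs))) (hd xs))"
| minimize: "partial_recursive (Suc n) f \<Longrightarrow>
    partial_recursive n
      (\<lambda>xs. if \<exists>z. f (z # xs) = Some 0 \<and> (\<forall>y<z. f (y # xs) \<noteq> None)
            then Some (LEAST z. f (z # xs) = Some 0) else None)"
| ext: "partial_recursive n f \<Longrightarrow> (\<And>xs. length xs = n \<Longrightarrow> g xs = f xs) \<Longrightarrow> partial_recursive n g"

definition partial_computable :: "(nat \<rightharpoonup> nat) \<Rightarrow> bool" where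
  "partial_computable \<phi> \<longleftrightarrow> partial_recursive 1 (\<lambda>xs. \<phi> (hd xs))"

definition ce :: "nat set \<Rightarrow> bool" where
  "ce W \<longleftrightarrow> (\<exists>\<phi>. partial_computable \<phi> \<and> W = dom \<phi>)"

definition computable_set :: "nat set \<Rightarrow> bool" where
  "computable_set S \<longleftrightarrow> partial_computable (\<lambda>x. Some (of_bool (x \<in> S)))"


section \<open>Cohesive sets\<close>

definition almost_subset :: "nat set \<Rightarrow> nat set \<Rightarrow> bool"  (infix \<open>\<subseteq>*\<close> 50) where
  "A \<subseteq>* B \<longleftrightarrow> finite (A - B)"

definition cohesive :: "nat set \<Rightarrow> bool" where
  "cohesive C \<longleftrightarrow> infinite C \<and> (\<forall>W. ce W \<longrightarrow> C \<subseteq>* W \<or> C \<subseteq>* (- W))"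


section \<open>Computable fields\<close>

text \<open>
  Closed terms of the language \<open>{0, 1, +, \<cdot>}\<close> expanded by a constant for every element. Negation
  and inversion are definable from these operations, so including them would not change which
  fields are computable.
\<close>

datatype 'a rterm =
    Elem 'a
  | Zero
  | One
  | Add "'a rterm" "'a rterm"
  | Mult "'a rterm" "'a rterm"

primrec rterm_val :: "('a, 'b) ring_scheme \<Rightarrow> 'a rterm \<Rightarrow> 'a" where
  "rterm_val A (Elem a) = a"
| "rterm_val A Zero = \<zero>\<^bsub>A\<^esub>"
| "rterm_val A One = \<one>\<^bsub>A\<^esub>"
| "rterm_val A (Add s t) = rterm_val A s \<oplus>\<^bsub>A\<^esub> rterm_val A t"
| "rterm_val A (Mult s t) = rterm_val A s \<otimes>\<^bsub>A\<^esub> rterm_val A t"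

primrec rterm_code :: "nat rterm \<Rightarrow> nat" where
  "rterm_code (Elem a) = prod_encode (0, a)"
| "rterm_code Zero = prod_encode (1, 0)"
| "rterm_code One = prod_encode (2, 0)"
| "rterm_code (Add s t) = prod_encode (3, prod_encode (rterm_code s, rterm_code t))"
| "rterm_code (Mult s t) = prod_encode (4, prod_encode (rterm_code s, rterm_code t))"

text \<open>
  \<open>literal_code True s t\<close> and \<open>literal_code False s t\<close> are the codes of the sentences \<open>s = t\<close> and
  \<open>s \<noteq> t\<close>; the atomic diagram is the set of codes of those that hold in the structure.
\<close>

definition literal_code :: "bool \<Rightarrow> nat rterm \<Rightarrow> nat rterm \<Rightarrow> nat" where
  "literal_code b s t = prod_encode (of_bool b, prod_encode (rterm_code s, rterm_code t))"

definition atomic_diagram :: "nat ring \<Rightarrow> nat set" where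
  "atomic_diagram A =
    {literal_code (rterm_val A s = rterm_val A t) s t | s t.
       set_rterm s \<subseteq> carrier A \<and> set_rterm t \<subseteq> carrier A}"

definition computable_field :: "nat ring \<Rightarrow> bool" where
  "computable_field A \<longleftrightarrow>
    field A \<and> computable_set (carrier A) \<and> computable_set (atomic_diagram A)"

definition computable_presentation :: "nat ring \<Rightarrow> ('a, 'b) ring_scheme \<Rightarrow> bool" where
  "computable_presentation A K \<longleftrightarrow> computable_field A \<and> A \<simeq> K"


section \<open>Number fields and relative automorphism groups\<close>

text \<open>In characteristic zero, the prime subfield is the copy of the rationals inside the field.\<close>

definition prime_subfield :: "('a, 'b) ring_scheme \<Rightarrow> 'a set" where
  "prime_subfield K = generate_field K {}"

definition number_field :: "('a, 'b) ring_scheme \<Rightarrow> bool" where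
  "number_field K \<longleftrightarrow>
    field K \<and>
    (\<forall>n::nat. n > 0 \<longrightarrow> [n] \<cdot>\<^bsub>K\<^esub> \<one>\<^bsub>K\<^esub> \<noteq> \<zero>\<^bsub>K\<^esub>) \<and>
    ring.finite_dimension K (prime_subfield K) (carrier K)"

text \<open>As in \<^const>\<open>AutoGroup\<close>, automorphisms are extensional functions on the carrier.\<close>

definition field_Aut :: "('a, 'b) ring_scheme \<Rightarrow> 'a set \<Rightarrow> ('a \<Rightarrow> 'a) monoid" where
  "field_Aut L E = BijGroup (carrier L)
    \<lparr>carrier := {\<sigma> \<in> ring_hom L L \<inter> Bij (carrier L). \<forall>x\<in>E. \<sigma> x = x}\<rparr>"


section \<open>Cohesive powers\<close>

definition cp_functions :: "nat set \<Rightarrow> nat ring \<Rightarrow> (nat \<rightharpoonup> nat) set" where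
  "cp_functions C A = {\<phi>. partial_computable \<phi> \<and> ran \<phi> \<subseteq> carrier A \<and> C \<subseteq>* dom \<phi>}"

definition cp_rel :: "nat set \<Rightarrow> nat ring \<Rightarrow> ((nat \<rightharpoonup> nat) \<times> (nat \<rightharpoonup> nat)) set" where
  "cp_rel C A = {(\<phi>, \<psi>). \<phi> \<in> cp_functions C A \<and> \<psi> \<in> cp_functions C A \<and>
     C \<subseteq>* {i. \<exists>v. \<phi> i = Some v \<and> \<psi> i = Some v}}"

definition cp_class :: "nat set \<Rightarrow> nat ring \<Rightarrow> (nat \<rightharpoonup> nat) \<Rightarrow> (nat \<rightharpoonup> nat) set" where
  "cp_class C A \<phi> = cp_rel C A `` {\<phi>}"

definition pointwise :: "(nat \<Rightarrow> nat \<Rightarrow> nat) \<Rightarrow> (nat \<rightharpoonup> nat) \<Rightarrow> (nat \<rightharpoonup> nat) \<Rightarrow> (nat \<rightharpoonup> nat)" where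
  "pointwise f \<phi> \<psi> = (\<lambda>i. Option.bind (\<phi> i) (\<lambda>a. map_option (f a) (\<psi> i)))"

text \<open>
  Operations on classes are unions over all choices of representatives; since the result does not
  depend on the choice, these unions are single classes.
\<close>

definition cohesive_power :: "nat set \<Rightarrow> nat ring \<Rightarrow> (nat \<rightharpoonup> nat) set ring" where
  "cohesive_power C A =
    \<lparr>carrier = cp_functions C A // cp_rel C A,
     monoid.mult = (\<lambda>U V. \<Union>\<phi>\<in>U. \<Union>\<psi>\<in>V. cp_class C A (pointwise (\<otimes>\<^bsub>A\<^esub>) \<phi> \<psi>)),
     one = cp_class C A (\<lambda>_. Some \<one>\<^bsub>A\<^esub>),
     ring.zero = cp_class C A (\<lambda>_. Some \<zero>\<^bsub>A\<^esub>),
     ring.add = (\<lambda>U V. \<Union>\<phi>\<in>U. \<Union>\<psi>\<in>V. cp_class C A (pointwise (\<oplus>\<^bsub>A\<^esub>) \<phi> \<psi>))\<rparr>"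

text \<open>The part of the cohesive power of \<open>A\<close> given by functions with values in \<open>B \<subseteq> A\<close>.\<close>

definition cohesive_power_sub :: "nat set \<Rightarrow> nat ring \<Rightarrow> nat set \<Rightarrow> (nat \<rightharpoonup> nat) set set" where
  "cohesive_power_sub C A B = {U \<in> carrier (cohesive_power C A). \<exists>\<phi>\<in>U. ran \<phi> \<subseteq> B}"

end

theory Submission
  imports Defs
begin

text \<open>
  Fix a spanning list \<open>u\<^sub>1, \<dots>, u\<^sub>n\<close> of \<open>K\<close> over \<open>\<rat>\<close>. The rationals are computably enumerable in
  \<open>K\<close>, so an unbounded search computes from \<open>x \<in> K\<close> rational coordinates of \<open>x\<close>. Hence every
  automorphism of \<open>K\<close> is computable and acts on the cohesive power by composition; and the
  cohesive power is spanned over that of \<open>\<rat>\<close> by the constant classes of the \<open>u\<^sub>i\<close>, so that an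
  automorphism over the cohesive power of \<open>\<rat>\<close> is determined by its values on constants.
  Such a value is a class \<open>[\<phi>]\<close> with \<open>p(\<phi>(i)) = 0\<close> for almost all \<open>i \<in> C\<close>, where \<open>p\<close> is a nonzero
  rational polynomial killing the constant. As \<open>p\<close> has finitely many roots, cohesiveness makes
  \<open>\<phi>\<close> constant almost everywhere on \<open>C\<close>: the automorphism maps constants to constants and restricts
  to an automorphism of \<open>K\<close>.
\<close>


section \<open>Total computable functions\<close>

text \<open>Totality is built into the type of \<open>f\<close>, so closure rules compose without
  option bookkeeping.\<close>

definition recursive :: "nat \<Rightarrow> (nat list \<Rightarrow> nat) \<Rightarrow> bool" where
  "recursive n f \<longleftrightarrow> partial_recursive n (\<lambda>xs. Some (f xs))"

definition decidable :: "nat \<Rightarrow> (nat list \<Rightarrow> bool) \<Rightarrow> bool" where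
  "decidable n P \<longleftrightarrow> recursive n (\<lambda>xs. of_bool (P xs))"

lemma recursive_cong: "recursive n f \<Longrightarrow> (\<And>xs. length xs = n \<Longrightarrow> g xs = f xs) \<Longrightarrow> recursive n g"
  unfolding recursive_def by (rule partial_recursive.ext) auto

lemma decidable_cong: "decidable n P \<Longrightarrow> (\<And>xs. length xs = n \<Longrightarrow> Q xs = P xs) \<Longrightarrow> decidable n Q"
  unfolding decidable_def by (erule recursive_cong) simp

section \<open>Composition, projections and primitive recursion\<close>

lemma partial_recursive_comp1:
  assumes "partial_recursive 1 f" "partial_recursive n g"
  shows "partial_recursive n (\<lambda>xs. Option.bind (g xs) (\<lambda>a. f [a]))"
  by (rule partial_recursive.ext[OF partial_recursive.comp[of "[g]" f n]])
     (use assms in \<open>auto split: option.split simp: Option.bind_eq_Some_conv\<close>)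

lemma partial_recursive_comp2:
  assumes "partial_recursive 2 f" "partial_recursive n g" "partial_recursive n h"
  shows "partial_recursive n (\<lambda>xs. Option.bind (g xs) (\<lambda>a. Option.bind (h xs) (\<lambda>b. f [a, b])))"
  by (rule partial_recursive.ext[OF partial_recursive.comp[of "[g, h]" f n]])
     (use assms in \<open>auto split: option.split simp: numeral_2_eq_2\<close>)

lemma those_map_Some: "those (map (\<lambda>g. Some (g xs)) gs) = Some (map (\<lambda>g. g xs) gs)"
  by (induction gs) auto

lemma partial_recursive_comp_total:
  assumes "partial_recursive (length gs) f" "\<And>g. g \<in> set gs \<Longrightarrow> recursive n g"
  shows "partial_recursive n (\<lambda>xs. f (map (\<lambda>g. g xs) gs))"
proof (rule partial_recursive.ext)
  show "partial_recursive n
      (\<lambda>xs. Option.bind (those (map (\<lambda>g. g xs) (map (\<lambda>g xs. Some (g xs)) gs))) f)"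
    using assms by (intro partial_recursive.comp) (auto simp: recursive_def)
qed (simp add: comp_def those_map_Some)

lemma recursive_comp:
  assumes "recursive (length gs) f" "\<And>g. g \<in> set gs \<Longrightarrow> recursive n g"
  shows "recursive n (\<lambda>xs. f (map (\<lambda>g. g xs) gs))"
  using partial_recursive_comp_total[of gs "\<lambda>xs. Some (f xs)"] assms unfolding recursive_def by auto

lemma recursive_nth: "i < n \<Longrightarrow> recursive n (\<lambda>xs. xs ! i)"
  unfolding recursive_def by (rule partial_recursive.proj)

lemma recursive_hd: "n > 0 \<Longrightarrow> recursive n hd"
  by (rule recursive_cong[OF recursive_nth[of 0]]) (auto simp: hd_conv_nth length_Suc_conv)

text \<open>This raises the arity: the parameters of a recursion or a search sit behind new leading
  arguments. The function is composed with the projections from position \<open>k\<close>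
  on.\<close>

lemma recursive_drop:
  assumes "recursive n f"
  shows "recursive (k + n) (\<lambda>xs. f (drop k xs))"
proof (rule recursive_cong)
  show "recursive (k + n) (\<lambda>xs. f (map (\<lambda>g. g xs) (map (\<lambda>i xs. xs ! (k + i)) [0..<n])))"
    by (rule recursive_comp) (auto intro!: recursive_nth assms)
next
  fix xs :: "nat list"
  assume "length xs = k + n"
  then have "drop k xs = map (\<lambda>i. xs ! (k + i)) [0..<n]"
    by (intro nth_equalityI) auto
  then show "f (drop k xs) = f (map (\<lambda>g. g xs) (map (\<lambda>i xs. xs ! (k + i)) [0..<n]))"
    by (simp add: comp_def)
qed

lemma recursive_tl: "recursive n f \<Longrightarrow> recursive (Suc n) (\<lambda>xs. f (tl xs))"
  using recursive_drop[of n f 1] by (simp add: drop_Suc)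

lemma recursive_comp1:
  assumes "recursive 1 (\<lambda>xs. f (hd xs))" "recursive n g"
  shows "recursive n (\<lambda>xs. f (g xs))"
  using recursive_comp[of "[g]" "\<lambda>xs. f (hd xs)" n] assms by simp

lemma recursive_Suc: "recursive n f \<Longrightarrow> recursive n (\<lambda>xs. Suc (f xs))"
  using partial_recursive.succ by (rule_tac recursive_comp1[where f = Suc])
    (simp_all add: recursive_def)

lemma recursive_const: "recursive n (\<lambda>_. c)"
  by (induction c) (auto simp: recursive_def intro: partial_recursive.zero
    recursive_Suc[unfolded recursive_def])

text \<open>The rule \<open>prim_rec\<close> recurses on the head of the argument list. Here the
  number of steps \<open>h xs\<close> is itself computed from the parameters, the form in which
  recursions are nested below.\<close>

lemma recursive_rec_nat:
  assumes f: "recursive n f"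
    and g: "recursive (Suc (Suc n)) (\<lambda>ys. g (ys ! 0) (ys ! 1) (drop 2 ys))" and h: "recursive n h"
  shows "recursive n (\<lambda>xs. rec_nat (f xs) (\<lambda>k v. g k v xs) (h xs))"
proof -
  \<comment> \<open>Base and step never fail, so the recursion on options stays inside
    \<open>Some\<close>.\<close>
  have *: "rec_nat (Some a) (\<lambda>k r. Option.bind r (\<lambda>v. Some (s k v))) m = Some (rec_nat a s m)"
    for a s and m :: nat
    by (induction m) auto
  have "partial_recursive (Suc n)
      (\<lambda>xs. rec_nat (Some (f (tl xs))) (\<lambda>k r. Option.bind r
         (\<lambda>v. (\<lambda>ys. Some (g (ys ! 0) (ys ! 1) (drop 2 ys))) (k # v # tl xs))) (hd xs))"
    using f g unfolding recursive_def by (intro partial_recursive.prim_rec)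
  then have rec: "recursive (Suc n) (\<lambda>xs. rec_nat (f (tl xs)) (\<lambda>k v. g k v (tl xs)) (hd xs))"
    by (simp add: * recursive_def)
  \<comment> \<open>The head is \<open>h xs\<close>, and the \<open>n\<close> projections behind it
    rebuild \<open>xs\<close> as the parameter list.\<close>
  have "recursive n (\<lambda>xs. (\<lambda>xs. rec_nat (f (tl xs)) (\<lambda>k v. g k v (tl xs)) (hd xs))
      (map (\<lambda>g. g xs) (h # map (\<lambda>i xs. xs ! i) [0..<n])))"
    by (rule recursive_comp) (auto intro!: rec h recursive_nth)
  moreover have "map (\<lambda>i. xs ! i) [0..<n] = xs" if "length xs = n" for xs :: "nat list"
    using map_nth[of xs] that by simp
  ultimately show ?thesis
    by (elim recursive_cong) (simp add: comp_def)
qed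

section \<open>Arithmetic and decidable predicates\<close>

lemma recursive_add: "recursive n f \<Longrightarrow> recursive n g \<Longrightarrow> recursive n (\<lambda>xs. f xs + g xs)"
proof -
  assume "recursive n f" "recursive n g"
  then have "recursive n (\<lambda>xs. rec_nat (f xs) (\<lambda>_ v. Suc v) (g xs))"
    by (intro recursive_rec_nat recursive_Suc recursive_nth) auto
  moreover have "rec_nat a (\<lambda>_ v. Suc v) b = a + b" for a b
    by (induction b) auto
  ultimately show ?thesis by simp
qed

lemma recursive_mult: "recursive n f \<Longrightarrow> recursive n g \<Longrightarrow> recursive n (\<lambda>xs. f xs * g xs)"
proof -
  assume f: "recursive n f" and g: "recursive n g"
  have "recursive (2 + n) (\<lambda>ys. f (drop 2 ys))"
    by (rule recursive_drop[OF f])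
  with f g have "recursive n (\<lambda>xs. rec_nat 0 (\<lambda>_ v. v + f xs) (g xs))"
    by (intro recursive_rec_nat recursive_add recursive_nth recursive_const) auto
  moreover have "rec_nat 0 (\<lambda>_ v. v + a) b = a * b" for a b :: nat
    by (induction b) auto
  ultimately show ?thesis by simp
qed

lemma recursive_diff: "recursive n f \<Longrightarrow> recursive n g \<Longrightarrow> recursive n (\<lambda>xs. f xs - g xs)"
proof -
  assume f: "recursive n f" and g: "recursive n g"
  \<comment> \<open>The predecessor is a recursion that ignores its accumulator and returns the
    counter, so 0 goes to 0. Truncated subtraction iterates it.\<close>
  have pred: "recursive m (\<lambda>xs. h xs - 1)" if "recursive m h" for m h
  proof -
    have "recursive m (\<lambda>xs. rec_nat 0 (\<lambda>k _. k) (h xs))"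
      by (intro recursive_rec_nat recursive_const recursive_nth that) auto
    moreover have "rec_nat 0 (\<lambda>k _. k) b = b - 1" for b :: nat
      by (cases b) auto
    ultimately show ?thesis by simp
  qed
  have "recursive n (\<lambda>xs. rec_nat (f xs) (\<lambda>_ v. v - 1) (g xs))"
    by (intro recursive_rec_nat f g pred recursive_nth) auto
  moreover have "rec_nat a (\<lambda>_ v. v - 1) b = a - b" for a b :: nat
    by (induction b) auto
  ultimately show ?thesis by simp
qed

lemma recursive_of_bool: "decidable n P \<Longrightarrow> recursive n (\<lambda>xs. of_bool (P xs))"
  by (simp add: decidable_def)

lemma decidable_not: "decidable n P \<Longrightarrow> decidable n (\<lambda>xs. \<not> P xs)"
  using recursive_diff[OF recursive_const[of n 1], of "\<lambda>xs. of_bool (P xs)"] unfolding decidable_def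
  by (rule recursive_cong) auto

lemma decidable_conj: "decidable n P \<Longrightarrow> decidable n Q \<Longrightarrow> decidable n (\<lambda>xs. P xs \<and> Q xs)"
  using recursive_mult[of n "\<lambda>xs. of_bool (P xs)" "\<lambda>xs. of_bool (Q xs)"] unfolding decidable_def
  by (simp add: of_bool_conj)

lemma decidable_disj: "decidable n P \<Longrightarrow> decidable n Q \<Longrightarrow> decidable n (\<lambda>xs. P xs \<or> Q xs)"
  using decidable_not[OF decidable_conj[OF decidable_not decidable_not], of n P Q] by simp

text \<open>Truncated subtraction decides the order: \<open>1 - (f xs - g xs)\<close> is 1 if the
  inner difference vanishes and 0 otherwise.\<close>

lemma decidable_le: "recursive n f \<Longrightarrow> recursive n g \<Longrightarrow> decidable n (\<lambda>xs. f xs \<le> g xs)"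
  using recursive_diff[OF recursive_const[of n 1] recursive_diff, of f g] unfolding decidable_def
  by (rule recursive_cong) auto

lemma decidable_eq: "recursive n f \<Longrightarrow> recursive n g \<Longrightarrow> decidable n (\<lambda>xs. f xs = g xs)"
  using decidable_conj[OF decidable_le decidable_le, of n f g g f] by (rule decidable_cong) auto

lemma decidable_less: "recursive n f \<Longrightarrow> recursive n g \<Longrightarrow> decidable n (\<lambda>xs. f xs < g xs)"
  using decidable_not[OF decidable_le, of n g f] by (rule decidable_cong) auto

lemma decidable_mem:
  assumes "computable_set S" "recursive n f"
  shows "decidable n (\<lambda>xs. f xs \<in> S)"
  using assms unfolding decidable_def computable_set_def partial_computable_def
  by (rule_tac recursive_comp1[where f = "\<lambda>x. of_bool (x \<in> S)"]) (auto simp: recursive_def)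

lemma recursive_if:
  "decidable n P \<Longrightarrow> recursive n f \<Longrightarrow> recursive n g \<Longrightarrow> recursive n (\<lambda>xs. if P xs then f xs else g xs)"
  using recursive_add[OF recursive_mult[OF recursive_of_bool]
    recursive_mult[OF recursive_of_bool[OF decidable_not]], of n P f P g]
  by (rule recursive_cong) auto

section \<open>Unbounded search and Cantor pairing\<close>

lemma recursive_Least:
  assumes P: "decidable (Suc n) (\<lambda>ys. P (hd ys) (tl ys))"
    and ex: "\<And>xs. length xs = n \<Longrightarrow> \<exists>z. P z xs"
  shows "recursive n (\<lambda>xs. LEAST z. P z xs)"
proof -
  \<comment> \<open>Minimization looks for a zero, hence the characteristic function of the
    negation. By \<open>ex\<close> the search halts on every input.\<close>
  have "partial_recursive (Suc n) (\<lambda>ys. Some (of_bool (\<not> P (hd ys) (tl ys))))"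
    using decidable_not[OF P] by (simp add: decidable_def recursive_def)
  from partial_recursive.minimize[OF this] show ?thesis
    unfolding recursive_def by (rule partial_recursive.ext) (use ex in auto)
qed

lemma recursive_triangle:
  assumes "recursive n f"
  shows "recursive n (\<lambda>xs. triangle (f xs))"
proof -
  have "recursive n (\<lambda>xs. rec_nat 0 (\<lambda>k v. v + Suc k) (f xs))"
    by (intro recursive_rec_nat recursive_const recursive_add recursive_Suc recursive_nth assms)
      auto
  moreover have "rec_nat 0 (\<lambda>k v. v + Suc k) m = triangle m" for m
    by (induction m) auto
  ultimately show ?thesis by simp
qed

lemma recursive_prod_encode:
  "recursive n f \<Longrightarrow> recursive n g \<Longrightarrow> recursive n (\<lambda>xs. prod_encode (f xs, g xs))"
  unfolding prod_encode_def by (auto intro!: recursive_add recursive_triangle)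

text \<open>Here \<open>s\<close> is the index of the diagonal of the Cantor pairing that contains
  \<open>z\<close>, that is, the sum of the two coordinates. Decoding thus becomes one search
  followed by subtractions, which shows that it is computable.\<close>

lemma prod_decode_Least:
  fixes z defines "s \<equiv> LEAST s. z < triangle (Suc s)"
  shows "prod_decode z = (z - triangle s, s - (z - triangle s))"
proof -
  obtain a b where z: "z = prod_encode (a, b)"
    using that[of "fst (prod_decode z)" "snd (prod_decode z)"] by simp
  have mono: "triangle m \<le> triangle k" if "m \<le> k" for m k
    using that by (rule_tac lift_Suc_mono_le[of triangle]) auto
  have "s = a + b"
    unfolding s_def
  proof (rule Least_equality)
    show "z < triangle (Suc (a + b))" by (simp add: z prod_encode_def)
    show "a + b \<le> y" if "z < triangle (Suc y)" for y
    proof (rule ccontr)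
      assume "\<not> a + b \<le> y"
      then have "triangle (Suc y) \<le> triangle (a + b)" by (intro mono) auto
      with that show False by (simp add: z prod_encode_def)
    qed
  qed
  then show ?thesis by (simp add: z) (simp add: prod_encode_def)
qed

lemma recursive_prod_decode:
  assumes "recursive n f"
  shows "recursive n (\<lambda>xs. fst (prod_decode (f xs)))" "recursive n (\<lambda>xs. snd (prod_decode (f xs)))"
proof -
  \<comment> \<open>The search for the diagonal halts by \<open>s = z\<close> at the latest, since
    \<open>triangle (Suc z)\<close> is at least \<open>Suc z\<close>.\<close>
  have "\<exists>s. z < triangle (Suc s)" for z
    by (rule exI[of _ z]) simp
  then have s: "recursive n (\<lambda>xs. LEAST s. f xs < triangle (Suc s))"
    by (intro recursive_Least decidable_less recursive_tl assms recursive_triangle recursive_Suc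
      recursive_hd) auto
  show "recursive n (\<lambda>xs. fst (prod_decode (f xs)))" "recursive n (\<lambda>xs. snd (prod_decode (f xs)))"
    unfolding prod_decode_Least fst_conv snd_conv by
      (intro recursive_diff assms recursive_triangle s)+
qed

section \<open>Unary partial computable functions\<close>

lemma partial_computable_total: "recursive 1 (\<lambda>xs. f (hd xs)) \<Longrightarrow> partial_computable (\<lambda>x. Some (f x))"
  by (simp add: partial_computable_def recursive_def)

lemma partial_computable_map:
  assumes "recursive 1 (\<lambda>xs. f (hd xs))" "partial_computable \<phi>"
  shows "partial_computable (\<lambda>i. map_option f (\<phi> i))"
  using partial_recursive_comp1[of "\<lambda>xs. Some (f (hd xs))" 1 "\<lambda>xs. \<phi> (hd xs)"] assms
  by (simp add: partial_computable_def recursive_def map_conv_bind_option comp_def)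

lemma partial_computable_pointwise:
  assumes "recursive 2 (\<lambda>xs. f (xs ! 0) (xs ! 1))" "partial_computable \<phi>" "partial_computable \<psi>"
  shows "partial_computable (pointwise f \<phi> \<psi>)"
  using partial_recursive_comp2[of "\<lambda>xs. Some (f (xs ! 0) (xs ! 1))" 1 "\<lambda>xs. \<phi> (hd xs)"
    "\<lambda>xs. \<psi> (hd xs)"]
    assms
  by (simp add: partial_computable_def recursive_def map_conv_bind_option comp_def pointwise_def)

text \<open>The fiber is the domain of a search whose test ignores the search variable: it stops at
  once if the value is \<open>r\<close>, and never if the value differs from \<open>r\<close> or is
  undefined. Cohesiveness will be applied to these fibers.\<close>

lemma ce_fiber:
  assumes "partial_computable \<phi>"
  shows "ce {i. \<phi> i = Some r}"
proof -
  let ?f = "\<lambda>i. map_option (\<lambda>a. of_bool (a \<noteq> r) :: nat) (\<phi> i)"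
  have "partial_computable ?f"
    by (intro partial_computable_map recursive_of_bool decidable_not decidable_eq recursive_hd
      recursive_const assms) auto
  from partial_recursive_comp1[OF this[unfolded partial_computable_def], of "Suc 1"
    "\<lambda>ys. Some (ys ! 1)"]
  \<comment> \<open>The head of \<open>ys\<close> is the idle search variable; the actual input is
    \<open>ys ! 1\<close>.\<close>
  have "partial_recursive (Suc 1) (\<lambda>ys. ?f (ys ! 1))"
    using recursive_nth[of 1 "Suc 1"] by (simp add: recursive_def)
  from partial_recursive.minimize[OF this]
  have "partial_computable (\<lambda>i. if \<phi> i = Some r then Some (LEAST z. ?f i = Some 0) else None)"
    unfolding partial_computable_def
    by (rule partial_recursive.ext) (auto simp: hd_conv_nth length_Suc_conv)
  then show ?thesis
    unfolding ce_def
    by (intro exI[of _ "\<lambda>i. if \<phi> i = Some r then Some (LEAST z. ?f i = Some 0) else None"])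
       (auto simp: dom_def)
qed


section \<open>Arithmetic of a computable field\<close>

lemma rterm_code_inject: "rterm_code s = rterm_code t \<longleftrightarrow> s = t"
proof
  show "rterm_code s = rterm_code t \<Longrightarrow> s = t"
  proof (induction s arbitrary: t)
    case (Elem x) then show ?case by (cases t) auto
  next
    case Zero then show ?case by (cases t) auto
  next
    case One then show ?case by (cases t) auto
  next
    case (Add s1 s2) from Add.prems show ?case by (cases t) (auto dest: Add.IH)
  next
    case (Mult s1 s2) from Mult.prems show ?case by (cases t) (auto dest: Mult.IH)
  qed
qed simp

text \<open>Coding is injective, so a code in the diagram comes from one literal only, and
  membership expresses the truth of that literal.\<close>

lemma literal_code_mem_atomic_diagram:
  "literal_code b s t \<in> atomic_diagram A \<longleftrightarrow>
     set_rterm s \<subseteq> carrier A \<and> set_rterm t \<subseteq> carrier A \<and> (b \<longleftrightarrow> rterm_val A s = rterm_val A t)"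
  by (auto simp: atomic_diagram_def literal_code_def rterm_code_inject)

locale computable_field_arith = field A for A :: "nat ring" (structure) +
  assumes computable_carrier: "computable_set (carrier A)"
    and computable_diagram: "computable_set (atomic_diagram A)"
begin

text \<open>Unlike \<open>\<oplus>\<close> and \<open>\<otimes>\<close>, these are specified, hence computable, off the carrier.\<close>

definition add0 :: "nat \<Rightarrow> nat \<Rightarrow> nat" where
  "add0 x y = (if x \<in> carrier A \<and> y \<in> carrier A then x \<oplus> y else 0)"

definition mult0 :: "nat \<Rightarrow> nat \<Rightarrow> nat" where
  "mult0 x y = (if x \<in> carrier A \<and> y \<in> carrier A then x \<otimes> y else 0)"


text \<open>The result of an operation is found by running through all \<open>z\<close> until the
  diagram confirms the equation with right-hand side \<open>z\<close>. The term former
  \<open>T\<close> and its tag \<open>c\<close> are parameters so that one argument serves addition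
  and multiplication.\<close>

lemma recursive_op_search:
  assumes f: "recursive n f" and g: "recursive n g"
    and T:
      "\<And>x y. rterm_code (T x y) = prod_encode
      (c, prod_encode (prod_encode (0, x), prod_encode (0, y)))"
    and op: "\<And>x y. op0 x y = (if x \<in> carrier A \<and> y \<in> carrier A then rterm_val A (T x y) else 0)"
    and closed: "\<And>x y. x \<in> carrier A \<Longrightarrow> y \<in> carrier A \<Longrightarrow> rterm_val A (T x y) \<in> carrier A"
    and set: "\<And>x y. set_rterm (T x y) = {x, y}"
  shows "recursive n (\<lambda>xs. op0 (f xs) (g xs))"
proof -
  \<comment> \<open>Off the carrier the first disjunct stops the search at 0, the default value of
    \<open>op0\<close>; on the carrier the value of the term is the only solution.\<close>
  have eq: "op0 x y = (LEAST z. \<not> (x \<in> carrier A \<and> y \<in> carrier A) \<or>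
      literal_code True (T x y) (Elem z) \<in> atomic_diagram A)" for x y
  proof (cases "x \<in> carrier A \<and> y \<in> carrier A")
    case True
    then show ?thesis
      using closed[of x y]
      by (auto simp: literal_code_mem_atomic_diagram set op intro!: Least_equality[symmetric])
  qed (auto simp: op)
  have mem: "decidable (Suc n) (\<lambda>ys. h (tl ys) \<in> carrier A)" if "recursive n h" for h
    by (intro decidable_mem computable_carrier recursive_tl that)
  have ex: "\<exists>z. \<not> (x \<in> carrier A \<and> y \<in> carrier A) \<or>
      literal_code True (T x y) (Elem z) \<in> atomic_diagram A" for x y
    using closed[of x y] by (auto simp: literal_code_mem_atomic_diagram set)
  show ?thesis
    unfolding eq
  proof (rule recursive_Least)
    show "decidable (Suc n) (\<lambda>ys. \<not> (f (tl ys) \<in> carrier A \<and> g (tl ys) \<in> carrier A) \<or>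
        literal_code True (T (f (tl ys)) (g (tl ys))) (Elem (hd ys)) \<in> atomic_diagram A)"
      unfolding literal_code_def T rterm_code.simps
      by (intro decidable_disj decidable_not decidable_conj mem f g decidable_mem
        computable_diagram recursive_prod_encode recursive_const
            recursive_tl[OF f] recursive_tl[OF g] recursive_hd) simp
  qed (use ex in auto)
qed

lemma recursive_add0: "recursive n f \<Longrightarrow> recursive n g \<Longrightarrow> recursive n (\<lambda>xs. add0 (f xs) (g xs))"
  by (rule recursive_op_search[where T = "\<lambda>x y. Add (Elem x) (Elem y)" and c = 3])
    (auto simp: add0_def)

lemma recursive_mult0: "recursive n f \<Longrightarrow> recursive n g \<Longrightarrow> recursive n (\<lambda>xs. mult0 (f xs) (g xs))"
  by (rule recursive_op_search[where T = "\<lambda>x y. Mult (Elem x) (Elem y)" and c = 4])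
    (auto simp: mult0_def)

section \<open>Fractions and a computable enumeration of the prime subfield\<close>

definition nat_mult_one :: "nat \<Rightarrow> nat" where
  "nat_mult_one n = rec_nat \<zero> (\<lambda>_ v. add0 v \<one>) n"

lemma recursive_nat_mult_one: "recursive n f \<Longrightarrow> recursive n (\<lambda>xs. nat_mult_one (f xs))"
  unfolding nat_mult_one_def by (intro recursive_rec_nat recursive_add0 recursive_const
    recursive_nth) auto

lemma nat_mult_one_closed [simp]: "nat_mult_one n \<in> carrier A"
  by (induction n) (auto simp: nat_mult_one_def add0_def)

lemma nat_mult_one_Suc: "nat_mult_one (Suc n) = nat_mult_one n \<oplus> \<one>"
  using nat_mult_one_closed[of n] by (simp add: nat_mult_one_def add0_def)

lemma nat_mult_one_0: "nat_mult_one 0 = \<zero>"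
  by (simp add: nat_mult_one_def)

lemma nat_mult_one_add: "nat_mult_one (m + n) = nat_mult_one m \<oplus> nat_mult_one n"
  by (induction n) (auto simp: nat_mult_one_0 nat_mult_one_Suc a_assoc)

lemma nat_mult_one_mult: "nat_mult_one (m * n) = nat_mult_one m \<otimes> nat_mult_one n"
  by (induction n)
     (auto simp: nat_mult_one_0 nat_mult_one_Suc nat_mult_one_add r_distr add.m_comm)

text \<open>This is the image of the integers in the field.\<close>

definition int_multiples :: "nat set" where
  "int_multiples = {nat_mult_one m \<ominus> nat_mult_one n | m n. True}"

lemma int_multiplesI: "x = nat_mult_one m \<ominus> nat_mult_one n \<Longrightarrow> x \<in> int_multiples"
  by (auto simp: int_multiples_def)

lemma int_multiples_closed: "x \<in> int_multiples \<Longrightarrow> x \<in> carrier A"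
  by (auto simp: int_multiples_def)

lemma one_int_multiples: "\<one> \<in> int_multiples"
  by (rule int_multiplesI[of _ 1 0]) (simp add: nat_mult_one_def a_minus_def add0_def)

lemma int_multiples_uminus: "x \<in> int_multiples \<Longrightarrow> \<ominus> x \<in> int_multiples"
  unfolding int_multiples_def
  by (clarsimp simp: a_minus_def minus_add) (metis add.m_comm a_inv_closed nat_mult_one_closed)

lemma int_multiples_add:
  assumes "x \<in> int_multiples" "y \<in> int_multiples"
  shows "x \<oplus> y \<in> int_multiples"
proof -
  from assms obtain m n k l where
    x: "x = nat_mult_one m \<ominus> nat_mult_one n" and y: "y = nat_mult_one k \<ominus> nat_mult_one l"
    by (auto simp: int_multiples_def)
  have "(a \<ominus> b) \<oplus> (c \<ominus> d) = (a \<oplus> c) \<ominus> (b \<oplus> d)"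
    if "a \<in> carrier A" "b \<in> carrier A" "c \<in> carrier A" "d \<in> carrier A" for a b c d
    using that by algebra
  then show ?thesis
    by (intro int_multiplesI[of _ "m + k" "n + l"]) (simp add: x y nat_mult_one_add)
qed

lemma int_multiples_mult:
  assumes "x \<in> int_multiples" "y \<in> int_multiples"
  shows "x \<otimes> y \<in> int_multiples"
proof -
  from assms obtain m n k l where
    x: "x = nat_mult_one m \<ominus> nat_mult_one n" and y: "y = nat_mult_one k \<ominus> nat_mult_one l"
    by (auto simp: int_multiples_def)
  have "(a \<ominus> b) \<otimes> (c \<ominus> d) = (a \<otimes> c \<oplus> b \<otimes> d) \<ominus> (a \<otimes> d \<oplus> b \<otimes> c)"
    if "a \<in> carrier A" "b \<in> carrier A" "c \<in> carrier A" "d \<in> carrier A" for a b c d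
    using that by algebra
  then show ?thesis
    by (intro int_multiplesI[of _ "m * k + n * l" "m * l + n * k"])
       (simp add: x y nat_mult_one_add nat_mult_one_mult)
qed

lemma prime_subfield_closed: "x \<in> prime_subfield A \<Longrightarrow> x \<in> carrier A"
  unfolding prime_subfield_def by (rule generate_field_in_carrier) auto

lemma subfield_prime_subfield: "subfield (prime_subfield A) A"
  unfolding prime_subfield_def by (rule generate_field_is_subfield) auto

lemma zero_prime_subfield: "\<zero> \<in> prime_subfield A"
  using subringE(2)[OF subfieldE(1)[OF subfield_prime_subfield]] .

text \<open>Integer fractions are closed under the field operations, so induction on the generation
  of the subfield applies. The denominator is cleared because equations between integers are what
  the enumeration can test.\<close>

lemma prime_subfield_fraction:
  assumes "x \<in> prime_subfield A"
  shows "\<exists>c\<in>int_multiples. c \<noteq> \<zero> \<and> c \<otimes> x \<in> int_multiples"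
  using assms unfolding prime_subfield_def
proof (induction rule: generate_field.induct)
  case one
  show ?case using one_int_multiples by (intro bexI[of _ \<one>]) auto
next
  case (a_inv x)
  then obtain c where "c \<in> int_multiples" "c \<noteq> \<zero>" "c \<otimes> x \<in> int_multiples" by auto
  moreover have "x \<in> carrier A" using generate_field_in_carrier[OF _ a_inv.hyps] by auto
  ultimately show ?case
    using int_multiples_uminus[of "c \<otimes> x"]
    by (intro bexI[of _ c]) (auto simp: int_multiples_closed r_minus)
next
  case (m_inv x)
  then obtain c where c: "c \<in> int_multiples" "c \<noteq> \<zero>" "c \<otimes> x \<in> int_multiples" by auto
  have x: "x \<in> carrier A" using generate_field_in_carrier[OF _ m_inv.hyps(1)] by auto
  then have inv: "inv x \<in> carrier A" "x \<otimes> inv x = \<one>"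
    using m_inv.hyps(2) field_Units by auto
  \<comment> \<open>The numerator \<open>c \<otimes> x\<close> of \<open>x\<close> serves as
    denominator of the inverse, with numerator \<open>c\<close>.\<close>
  have "c \<otimes> x \<otimes> inv x = c"
    using inv x c by (simp add: int_multiples_closed m_assoc)
  with c x m_inv.hyps(2) show ?case
    by (intro bexI[of _ "c \<otimes> x"]) (auto simp: int_multiples_closed integral_iff)
next
  case (eng_add x y)
  then obtain c d where c: "c \<in> int_multiples" "c \<noteq> \<zero>" "c \<otimes> x \<in> int_multiples"
    and d: "d \<in> int_multiples" "d \<noteq> \<zero>" "d \<otimes> y \<in> int_multiples" by auto
  have xy: "x \<in> carrier A" "y \<in> carrier A"
    using generate_field_in_carrier eng_add.hyps by blast+
  note cd = int_multiples_closed[OF c(1)] int_multiples_closed[OF d(1)]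
  \<comment> \<open>The product \<open>c \<otimes> d\<close> is a common denominator.\<close>
  have "c \<otimes> d \<otimes> (x \<oplus> y) = d \<otimes> (c \<otimes> x) \<oplus> c \<otimes> (d \<otimes> y)"
    using xy cd by algebra
  then show ?case
    using c d cd by (intro bexI[of _ "c \<otimes> d"])
      (auto simp: integral_iff intro!: int_multiples_add int_multiples_mult)
next
  case (eng_mult x y)
  then obtain c d where c: "c \<in> int_multiples" "c \<noteq> \<zero>" "c \<otimes> x \<in> int_multiples"
    and d: "d \<in> int_multiples" "d \<noteq> \<zero>" "d \<otimes> y \<in> int_multiples" by auto
  have xy: "x \<in> carrier A" "y \<in> carrier A"
    using generate_field_in_carrier eng_mult.hyps by blast+
  note cd = int_multiples_closed[OF c(1)] int_multiples_closed[OF d(1)]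
  have "c \<otimes> d \<otimes> (x \<otimes> y) = (c \<otimes> x) \<otimes> (d \<otimes> y)"
    using xy cd by algebra
  then show ?case
    using c d cd by (intro bexI[of _ "c \<otimes> d"])
      (auto simp: integral_iff intro!: int_multiples_mult)
qed auto

lemma int_multiples_prime_subfield: "x \<in> int_multiples \<Longrightarrow> x \<in> prime_subfield A"
proof -
  note sr = subfieldE(1)[OF subfield_prime_subfield]
  have "nat_mult_one n \<in> prime_subfield A" for n
    by (induction n)
       (auto simp: nat_mult_one_0 nat_mult_one_Suc zero_prime_subfield subringE(3,7)[OF sr])
  then show "x \<in> int_multiples \<Longrightarrow> x \<in> prime_subfield A"
    by (auto simp: int_multiples_def a_minus_def subringE(5,7)[OF sr])
qed

text \<open>With \<open>prime_subfield_fraction\<close> this turns membership in the prime subfield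
  into the existence of an integer equation, the witness searched for by
  \<open>prime_enum\<close>.\<close>

lemma fraction_prime_subfield:
  assumes "x \<in> carrier A" "c \<in> int_multiples" "c \<noteq> \<zero>" "c \<otimes> x \<in> int_multiples"
  shows "x \<in> prime_subfield A"
proof -
  have c: "c \<in> carrier A" "inv c \<in> carrier A" "inv c \<otimes> c = \<one>"
    using assms int_multiples_closed field_Units by auto
  have "inv c \<in> prime_subfield A"
    using int_multiples_prime_subfield[OF assms(2)] assms(3) unfolding prime_subfield_def
    by (rule generate_field.m_inv)
  then have "inv c \<otimes> (c \<otimes> x) \<in> prime_subfield A"
    using int_multiples_prime_subfield[OF assms(4)] unfolding prime_subfield_def
    by (rule generate_field.eng_mult)
  then show ?thesis
    using c assms(1) by (simp flip: m_assoc)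
qed

text \<open>
  An enumeration of the prime subfield: the code \<open>((y, a, b), c, d)\<close> yields \<open>y\<close> if it witnesses
  \<open>(c - d) y = a - b\<close> with \<open>c - d \<noteq> 0\<close>, and \<open>0\<close> otherwise. Subtraction-free so that only the
  computability of addition and multiplication is needed.
\<close>

definition prime_enum :: "nat \<Rightarrow> nat" where
  "prime_enum z =
    (let y = fst (prod_decode (fst (prod_decode z)));
         a = fst (prod_decode (snd (prod_decode (fst (prod_decode z)))));
         b = snd (prod_decode (snd (prod_decode (fst (prod_decode z)))));
         c = fst (prod_decode (snd (prod_decode z)));
         d = snd (prod_decode (snd (prod_decode z)))
     in if y \<in> carrier A \<and> nat_mult_one c \<noteq> nat_mult_one d \<and>
           add0 (mult0 (nat_mult_one c) y) (nat_mult_one b) =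
           add0 (mult0 (nat_mult_one d) y) (nat_mult_one a)
        then y else \<zero>)"

lemma recursive_prime_enum: "recursive n f \<Longrightarrow> recursive n (\<lambda>xs. prime_enum (f xs))"
  unfolding prime_enum_def Let_def
  by (intro recursive_if decidable_conj decidable_mem computable_carrier decidable_not
    decidable_eq recursive_add0 recursive_mult0 recursive_nat_mult_one
        recursive_prod_decode recursive_const)

text \<open>Both sides of the right-hand equation become differences with the same subtrahend
  \<open>d \<otimes> y \<oplus> b\<close>; cancelling it leaves the subtraction-free test.\<close>

lemma fraction_iff:
  assumes "a \<in> carrier A" "b \<in> carrier A" "c \<in> carrier A" "d \<in> carrier A" "y \<in> carrier A"
  shows "add0 (mult0 c y) b = add0 (mult0 d y) a \<longleftrightarrow> (c \<ominus> d) \<otimes> y = a \<ominus> b"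
proof -
  have "(c \<ominus> d) \<otimes> y = (c \<otimes> y \<oplus> b) \<ominus> (d \<otimes> y \<oplus> b)"
    "a \<ominus> b = (d \<otimes> y \<oplus> a) \<ominus> (d \<otimes> y \<oplus> b)"
    using assms by algebra+
  then show ?thesis
    using assms by (auto simp: add0_def mult0_def a_minus_def)
qed

text \<open>A code that passes the test exhibits its first entry as a fraction, and the default
  value \<zero> is in the subfield too. Conversely, numerator and denominator of a fraction provide
  a code that passes.\<close>

lemma range_prime_enum: "range prime_enum = prime_subfield A"
proof (intro equalityI subsetI)
  fix x assume "x \<in> range prime_enum"
  then obtain z where z: "x = prime_enum z" by auto
  let ?y = "fst (prod_decode (fst (prod_decode z)))"
  let ?a = "fst (prod_decode (snd (prod_decode (fst (prod_decode z)))))"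
  let ?b = "snd (prod_decode (snd (prod_decode (fst (prod_decode z)))))"
  let ?c = "fst (prod_decode (snd (prod_decode z)))"
  let ?d = "snd (prod_decode (snd (prod_decode z)))"
  let ?e = "nat_mult_one ?c \<ominus> nat_mult_one ?d"
  consider "x = \<zero>" | "x = ?y" "?y \<in> carrier A" "nat_mult_one ?c \<noteq> nat_mult_one ?d"
      "?e \<otimes> ?y = nat_mult_one ?a \<ominus> nat_mult_one ?b"
    using z fraction_iff[of "nat_mult_one ?a" "nat_mult_one ?b" "nat_mult_one ?c"
      "nat_mult_one ?d" ?y]
    by (auto simp: prime_enum_def Let_def split: if_splits)
  then show "x \<in> prime_subfield A"
  proof cases
    case 2
    have "?e \<noteq> \<zero>"
      using 2(3) by simp
    from fraction_prime_subfield[OF 2(2) int_multiplesI[OF refl] this int_multiplesI[OF 2(4)]]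
    show ?thesis
      by (simp only: 2(1))
  qed (simp add: zero_prime_subfield)
next
  fix y assume y: "y \<in> prime_subfield A"
  then obtain e where e: "e \<in> int_multiples" "e \<noteq> \<zero>" "e \<otimes> y \<in> int_multiples"
    using prime_subfield_fraction by auto
  then obtain a b c d where "e = nat_mult_one c \<ominus> nat_mult_one d"
    "e \<otimes> y = nat_mult_one a \<ominus> nat_mult_one b"
    by (auto simp: int_multiples_def)
  moreover have "y \<in> carrier A" using y by (rule prime_subfield_closed)
  ultimately have "y = prime_enum
      (prod_encode (prod_encode (y, prod_encode (a, b)), prod_encode (c, d)))"
    using e(2) by (auto simp: prime_enum_def fraction_iff)
  then show "y \<in> range prime_enum" by blast
qed

end


section \<open>Cohesive powers of a computable field\<close>

lemma almost_subset_Int: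
  assumes "A \<subseteq>* B" "A \<subseteq>* B'" "B \<inter> B' \<subseteq> D"
  shows "A \<subseteq>* D"
proof -
  have "A - D \<subseteq> (A - B) \<union> (A - B')" using assms(3) by auto
  then show ?thesis
    using assms(1,2) unfolding almost_subset_def by (auto intro: finite_subset)
qed

lemma almost_subset_trans: "A \<subseteq>* B \<Longrightarrow> B \<subseteq> D \<Longrightarrow> A \<subseteq>* D"
  by (rule almost_subset_Int[of A B B]) auto

text \<open>If \<open>C\<close> were almost inside the complement of every \<open>W r\<close>, it
  would meet each of the finitely many sets in a finite set and hence be finite.\<close>

lemma cohesive_finite_Union:
  assumes "cohesive C" "finite R" "C \<subseteq>* (\<Union>r\<in>R. W r)" "\<And>r. r \<in> R \<Longrightarrow> ce (W r)"
  shows "\<exists>r\<in>R. C \<subseteq>* W r"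
proof (rule ccontr)
  assume "\<not> (\<exists>r\<in>R. C \<subseteq>* W r)"
  then have "C \<subseteq>* - W r" if "r \<in> R" for r
    using assms(1,4) that unfolding cohesive_def by auto
  then have "finite ((\<Union>r\<in>R. C - - W r) \<union> (C - (\<Union>r\<in>R. W r)))"
    using assms(2,3) unfolding almost_subset_def by blast
  then have "finite C"
    by (rule rev_finite_subset) auto
  with assms(1) show False
    by (simp add: cohesive_def)
qed

section \<open>Composition and pointwise operations on partial functions\<close>

definition map_partial :: "(nat \<Rightarrow> nat) \<Rightarrow> (nat \<rightharpoonup> nat) \<Rightarrow> nat \<rightharpoonup> nat" where
  "map_partial g \<phi> = (\<lambda>i. map_option g (\<phi> i))"

lemma dom_map_partial [simp]: "dom (map_partial g \<phi>) = dom \<phi>"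
  by (auto simp: map_partial_def dom_def)

lemma ran_map_partial: "ran (map_partial g \<phi>) = g ` ran \<phi>"
  by (auto simp: map_partial_def ran_def)

text \<open>Only values on the range count, so a map known only on the carrier may be replaced by a
  computable one that agrees with it there.\<close>

lemma map_partial_cong: "(\<And>x. x \<in> ran \<phi> \<Longrightarrow> f x = g x) \<Longrightarrow> map_partial f \<phi> = map_partial g \<phi>"
  by (auto simp: fun_eq_iff map_partial_def ran_def intro!: map_option_cong)

lemma map_partial_comp: "map_partial f (map_partial g \<phi>) = map_partial (\<lambda>x. f (g x)) \<phi>"
  by (simp add: map_partial_def option.map_comp comp_def)

lemma map_partial_const [simp]: "map_partial f (\<lambda>_. Some a) = (\<lambda>_. Some (f a))"
  by (simp add: map_partial_def)

lemma pointwise_map_partial: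
  "pointwise f (map_partial g \<phi>) (map_partial h \<phi>) = map_partial (\<lambda>x. f (g x) (h x)) \<phi>"
  proof
  fix i
  show "pointwise f (map_partial g \<phi>) (map_partial h \<phi>) i = map_partial (\<lambda>x. f (g x) (h x)) \<phi> i"
    by (cases "\<phi> i") (auto simp: pointwise_def map_partial_def)
qed

lemma map_partial_pointwise:
  assumes "\<And>x y. x \<in> S \<Longrightarrow> y \<in> S \<Longrightarrow> g (f x y) = f (g x) (g y)" "ran \<phi> \<subseteq> S" "ran \<psi> \<subseteq> S"
  shows "map_partial g (pointwise f \<phi> \<psi>) = pointwise f (map_partial g \<phi>) (map_partial g \<psi>)"
proof
  fix i
  show "map_partial g (pointwise f \<phi> \<psi>) i = pointwise f (map_partial g \<phi>) (map_partial g \<psi>) i"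
    using assms by (cases "\<phi> i"; cases "\<psi> i") (auto simp: map_partial_def pointwise_def ran_def)
qed

lemma dom_pointwise: "dom (pointwise f \<phi> \<psi>) = dom \<phi> \<inter> dom \<psi>"
  by (auto simp: pointwise_def dom_def Option.bind_eq_Some_conv)

text \<open>This is the relation of \<open>cp_rel\<close> without membership in
  \<open>cp_functions\<close>, so that agreement can be transported before closure of the operations
  is known.\<close>

definition agree :: "nat set \<Rightarrow> (nat \<rightharpoonup> nat) \<Rightarrow> (nat \<rightharpoonup> nat) \<Rightarrow> bool" where
  "agree C \<phi> \<psi> \<longleftrightarrow> C \<subseteq>* {i. \<exists>v. \<phi> i = Some v \<and> \<psi> i = Some v}"

section \<open>Classes, their ring operations and the constants\<close>

locale computable_field_cohesive = computable_field_arith A for A (structure) +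
  fixes C :: "nat set"
  assumes cohesive: "cohesive C"
begin

abbreviation "P \<equiv> cohesive_power C A"
abbreviation "cl \<equiv> cp_class C A"
abbreviation "fn \<equiv> cp_functions C A"

text \<open>Values are not confined to the carrier: these functions may also return codes of
  coordinate vectors.\<close>

definition almost_total :: "(nat \<rightharpoonup> nat) set" where
  "almost_total = {\<phi>. partial_computable \<phi> \<and> C \<subseteq>* dom \<phi>}"

lemma fn_almost_total: "\<phi> \<in> fn \<Longrightarrow> \<phi> \<in> almost_total"
  by (simp add: cp_functions_def almost_total_def)

lemma ran_fn: "\<phi> \<in> fn \<Longrightarrow> ran \<phi> \<subseteq> carrier A"
  by (simp add: cp_functions_def)

lemma map_partial_almost_total:
  "\<phi> \<in> almost_total \<Longrightarrow> recursive 1 (\<lambda>xs. g (hd xs)) \<Longrightarrow> map_partial g \<phi> \<in> almost_total"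
  using partial_computable_map[of g \<phi>] by (auto simp: almost_total_def) (simp add: map_partial_def)

lemma map_partial_fn:
  assumes "\<phi> \<in> almost_total" "recursive 1 (\<lambda>xs. g (hd xs))" "g ` ran \<phi> \<subseteq> carrier A"
  shows "map_partial g \<phi> \<in> fn"
  using map_partial_almost_total[OF assms(1,2)] assms(3)
  by (simp add: almost_total_def cp_functions_def ran_map_partial)

lemma map_partial_const_fn: "\<phi> \<in> almost_total \<Longrightarrow> a \<in> carrier A \<Longrightarrow> map_partial (\<lambda>_. a) \<phi> \<in> fn"
  by (rule map_partial_fn) (auto intro: recursive_const)

lemma const_fn: "a \<in> carrier A \<Longrightarrow> (\<lambda>_. Some a) \<in> fn"
  using partial_computable_total[OF recursive_const, of a]
  by (auto simp: cp_functions_def almost_subset_def dom_def ran_def)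

lemma agree_refl: "\<phi> \<in> almost_total \<Longrightarrow> agree C \<phi> \<phi>"
  by (auto simp: almost_total_def agree_def dom_def elim: almost_subset_trans)

lemma agree_sym: "agree C \<phi> \<psi> \<Longrightarrow> agree C \<psi> \<phi>"
  by (auto simp: agree_def elim: almost_subset_trans)

lemma agree_trans: "agree C \<phi> \<psi> \<Longrightarrow> agree C \<psi> \<chi> \<Longrightarrow> agree C \<phi> \<chi>"
  unfolding agree_def by (erule almost_subset_Int, assumption) auto

lemma cp_rel_iff: "(\<phi>, \<psi>) \<in> cp_rel C A \<longleftrightarrow> \<phi> \<in> fn \<and> \<psi> \<in> fn \<and> agree C \<phi> \<psi>"
  by (simp add: cp_rel_def agree_def)

lemma equiv_cp_rel: "equiv fn (cp_rel C A)"
  by (rule equivI)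
     (auto simp: cp_rel_iff refl_on_def sym_def trans_def agree_refl agree_sym fn_almost_total
        intro: agree_trans)

lemma cl_eq_iff: "\<phi> \<in> fn \<Longrightarrow> \<psi> \<in> fn \<Longrightarrow> cl \<phi> = cl \<psi> \<longleftrightarrow> agree C \<phi> \<psi>"
  using eq_equiv_class_iff[OF equiv_cp_rel, of \<phi> \<psi>] by (simp add: cp_class_def cp_rel_iff)

lemma mem_cl_iff: "\<phi> \<in> fn \<Longrightarrow> \<psi> \<in> cl \<phi> \<longleftrightarrow> \<psi> \<in> fn \<and> cl \<psi> = cl \<phi>"
  using agree_sym[of \<phi> \<psi>] agree_sym[of \<psi> \<phi>] cl_eq_iff[of \<psi> \<phi>]
  by (simp add: cp_class_def cp_rel_iff) blast

lemma carrier_P: "carrier P = cl ` fn"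
  by (auto simp: cohesive_power_def quotient_def cp_class_def)

lemma cl_eqI:
  assumes "\<phi> \<in> fn" "\<psi> \<in> fn" "\<And>i v w. \<phi> i = Some v \<Longrightarrow> \<psi> i = Some w \<Longrightarrow> v = w"
  shows "cl \<phi> = cl \<psi>"
proof -
  have "dom \<phi> \<inter> dom \<psi> \<subseteq> {i. \<exists>v. \<phi> i = Some v \<and> \<psi> i = Some v}"
    using assms(3) by fastforce
  with assms(1,2) show ?thesis
    by (auto simp: cl_eq_iff agree_def cp_functions_def intro: almost_subset_Int)
qed

text \<open>The operation \<open>f\<close> is unspecified off the carrier and need not be computable
  there; its computable variant \<open>f'\<close> gives the same pointwise result because both
  arguments take values in the carrier.\<close>

lemma pointwise_fn:
  assumes "\<phi> \<in> fn" "\<psi> \<in> fn"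
    and "\<And>x y. x \<in> carrier A \<Longrightarrow> y \<in> carrier A \<Longrightarrow> f x y \<in> carrier A \<and> f' x y = f x y"
    and "recursive 2 (\<lambda>xs. f' (xs ! 0) (xs ! 1))"
  shows "pointwise f \<phi> \<psi> \<in> fn"
proof -
  have "pointwise f' \<phi> \<psi> i = pointwise f \<phi> \<psi> i" for i
    using ran_fn[OF assms(1)] ran_fn[OF assms(2)] assms(3)
    by (cases "\<phi> i"; cases "\<psi> i") (auto simp: pointwise_def subset_iff intro: ranI)
  then have "pointwise f' \<phi> \<psi> = pointwise f \<phi> \<psi>" by auto
  moreover have "partial_computable (pointwise f' \<phi> \<psi>)" "C \<subseteq>* dom (pointwise f \<phi> \<psi>)"
    using assms(1,2) partial_computable_pointwise[OF assms(4), of \<phi> \<psi>]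
    by (auto simp: cp_functions_def dom_pointwise intro: almost_subset_Int)
  moreover have "ran (pointwise f \<phi> \<psi>) \<subseteq> carrier A"
  proof
    fix z assume "z \<in> ran (pointwise f \<phi> \<psi>)"
    then obtain x y where "x \<in> ran \<phi>" "y \<in> ran \<psi>" "z = f x y"
      by (auto simp: ran_def pointwise_def Option.bind_eq_Some_conv)
    then show "z \<in> carrier A"
      using ran_fn[OF assms(1)] ran_fn[OF assms(2)] assms(3)[of x y] by auto
  qed
  ultimately show ?thesis
    by (simp add: cp_functions_def)
qed

lemma agree_pointwise:
  "agree C \<phi> \<phi>' \<Longrightarrow> agree C \<psi> \<psi>' \<Longrightarrow> agree C (pointwise f \<phi> \<psi>) (pointwise f \<phi>' \<psi>')"
  unfolding agree_def by (erule almost_subset_Int, assumption) (auto simp: pointwise_def)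

text \<open>Agreement passes through pointwise operations, so the union over all representatives
  collapses to one class.\<close>

lemma class_op:
  assumes "\<phi> \<in> fn" "\<psi> \<in> fn"
    and fn: "\<And>\<phi> \<psi>. \<phi> \<in> fn \<Longrightarrow> \<psi> \<in> fn \<Longrightarrow> pointwise f \<phi> \<psi> \<in> fn"
  shows "(\<Union>\<phi>'\<in>cl \<phi>. \<Union>\<psi>'\<in>cl \<psi>. cl (pointwise f \<phi>' \<psi>')) = cl (pointwise f \<phi> \<psi>)"
proof -
  have "cl (pointwise f \<phi>' \<psi>') = cl (pointwise f \<phi> \<psi>)" if "\<phi>' \<in> cl \<phi>" "\<psi>' \<in> cl \<psi>" for \<phi>' \<psi>'
    using that assms by (auto simp: mem_cl_iff cl_eq_iff agree_pointwise)
  moreover have "\<phi> \<in> cl \<phi>" "\<psi> \<in> cl \<psi>"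
    using assms by (auto simp: mem_cl_iff)
  ultimately show ?thesis by blast
qed

lemma mult_fn: "\<phi> \<in> fn \<Longrightarrow> \<psi> \<in> fn \<Longrightarrow> pointwise (\<otimes>) \<phi> \<psi> \<in> fn"
  by (rule pointwise_fn[where f' = mult0])
    (simp_all add: recursive_mult0 recursive_nth, simp add: mult0_def)

lemma add_fn: "\<phi> \<in> fn \<Longrightarrow> \<psi> \<in> fn \<Longrightarrow> pointwise (\<oplus>) \<phi> \<psi> \<in> fn"
  by (rule pointwise_fn[where f' = add0])
    (simp_all add: recursive_add0 recursive_nth, simp add: add0_def)

lemma cl_mult: "\<phi> \<in> fn \<Longrightarrow> \<psi> \<in> fn \<Longrightarrow> cl \<phi> \<otimes>\<^bsub>P\<^esub> cl \<psi> = cl (pointwise (\<otimes>) \<phi> \<psi>)"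
  by (simp add: cohesive_power_def class_op mult_fn)

lemma cl_add: "\<phi> \<in> fn \<Longrightarrow> \<psi> \<in> fn \<Longrightarrow> cl \<phi> \<oplus>\<^bsub>P\<^esub> cl \<psi> = cl (pointwise (\<oplus>) \<phi> \<psi>)"
  by (simp add: cohesive_power_def class_op add_fn)

lemma one_P: "\<one>\<^bsub>P\<^esub> = cl (\<lambda>_. Some \<one>)"
  by (simp add: cohesive_power_def)

text \<open>The canonical embedding of the field into its cohesive power.\<close>

definition emb :: "nat \<Rightarrow> (nat \<rightharpoonup> nat) set" where
  "emb a = cl (\<lambda>_. Some a)"

lemma emb_closed: "a \<in> carrier A \<Longrightarrow> emb a \<in> carrier P"
  by (auto simp: emb_def carrier_P const_fn)

lemma emb_mult: "a \<in> carrier A \<Longrightarrow> b \<in> carrier A \<Longrightarrow> emb (a \<otimes> b) = emb a \<otimes>\<^bsub>P\<^esub> emb b"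
  by (simp add: emb_def cl_mult const_fn) (simp add: pointwise_def)

lemma emb_add: "a \<in> carrier A \<Longrightarrow> b \<in> carrier A \<Longrightarrow> emb (a \<oplus> b) = emb a \<oplus>\<^bsub>P\<^esub> emb b"
  by (simp add: emb_def cl_add const_fn) (simp add: pointwise_def)

lemma emb_one: "emb \<one> = \<one>\<^bsub>P\<^esub>"
  by (simp add: emb_def one_P)

text \<open>Distinct constants agree nowhere, and \<open>C\<close>, being infinite, is not almost
  contained in the empty set.\<close>

lemma emb_eq_iff: "a \<in> carrier A \<Longrightarrow> b \<in> carrier A \<Longrightarrow> emb a = emb b \<longleftrightarrow> a = b"
  using cohesive
  by (auto simp: emb_def cl_eq_iff const_fn agree_def almost_subset_def cohesive_def)

lemma cl_map_const: "\<phi> \<in> almost_total \<Longrightarrow> a \<in> carrier A \<Longrightarrow> cl (map_partial (\<lambda>_. a) \<phi>) = emb a"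
  unfolding emb_def
  by (rule cl_eqI[OF map_partial_const_fn const_fn]) (auto simp: map_partial_def)

text \<open>Expressions in one variable are computed in the cohesive power by substituting a class
  for it; this and \<open>cl_map_add\<close> supply the inductive steps for polynomials and linear
  combinations.\<close>

lemma cl_map_mult:
  assumes "map_partial g \<phi> \<in> fn" "map_partial h \<phi> \<in> fn"
  shows "map_partial (\<lambda>x. g x \<otimes> h x) \<phi> \<in> fn"
    "cl (map_partial (\<lambda>x. g x \<otimes> h x) \<phi>) = cl (map_partial g \<phi>) \<otimes>\<^bsub>P\<^esub> cl (map_partial h \<phi>)"
  using mult_fn[OF assms] cl_mult[OF assms] by (simp_all add: pointwise_map_partial)

lemma cl_map_add:
  assumes "map_partial g \<phi> \<in> fn" "map_partial h \<phi> \<in> fn"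
  shows "map_partial (\<lambda>x. g x \<oplus> h x) \<phi> \<in> fn"
    "cl (map_partial (\<lambda>x. g x \<oplus> h x) \<phi>) = cl (map_partial g \<phi>) \<oplus>\<^bsub>P\<^esub> cl (map_partial h \<phi>)"
  using add_fn[OF assms] cl_add[OF assms] by (simp_all add: pointwise_map_partial)

lemma cl_mem_sub: "\<phi> \<in> fn \<Longrightarrow> ran \<phi> \<subseteq> B \<Longrightarrow> cl \<phi> \<in> cohesive_power_sub C A B"
  by (auto simp: cohesive_power_sub_def carrier_P mem_cl_iff)

lemma emb_mem_sub: "a \<in> carrier A \<Longrightarrow> a \<in> B \<Longrightarrow> emb a \<in> cohesive_power_sub C A B"
  unfolding emb_def by (rule cl_mem_sub) (auto simp: const_fn ran_def)

end


section \<open>Automorphisms\<close>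

text \<open>Closure of \<open>G\<close> is what lets the inverse of \<open>h\<close> be applied to
  the image of a product. The isomorphism between automorphism groups can then be reversed without
  first proving them groups.\<close>

lemma iso_sym_magma:
  assumes "h \<in> Group.iso G H" "\<And>x y. x \<in> carrier G \<Longrightarrow> y \<in> carrier G \<Longrightarrow> x \<otimes>\<^bsub>G\<^esub> y \<in> carrier G"
  shows "H \<cong> G"
proof -
  let ?k = "inv_into (carrier G) h"
  have h: "h \<in> hom G H" "bij_betw h (carrier G) (carrier H)"
    using assms(1) by (auto simp: Group.iso_def)
  then have k: "bij_betw ?k (carrier H) (carrier G)"
    by (simp add: bij_betw_inv_into)
  have "?k \<in> hom H G"
  proof (rule homI)
    fix x y assume xy: "x \<in> carrier H" "y \<in> carrier H"
    then have k: "?k x \<in> carrier G" "?k y \<in> carrier G" "h (?k x) = x" "h (?k y) = y"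
      using h(2) bij_betwE[OF k] by (auto simp: bij_betw_inv_into_right)
    then have "h (?k x \<otimes>\<^bsub>G\<^esub> ?k y) = x \<otimes>\<^bsub>H\<^esub> y"
      using h(1) by (simp add: hom_mult)
    then show "?k (x \<otimes>\<^bsub>H\<^esub> y) = ?k x \<otimes>\<^bsub>G\<^esub> ?k y"
      using bij_betw_inv_into_left[OF h(2) assms(2)[OF k(1,2)]] by simp
  qed (use bij_betwE[OF k] in auto)
  with k show ?thesis
    by (auto simp: is_iso_def Group.iso_def)
qed

section \<open>Composition of relative automorphisms\<close>

lemma carrier_field_Aut:
  "\<alpha> \<in> carrier (field_Aut L E) \<longleftrightarrow> \<alpha> \<in> ring_hom L L \<and> \<alpha> \<in> Bij (carrier L) \<and> (\<forall>x\<in>E. \<alpha> x = x)"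
  by (auto simp: field_Aut_def)

lemma mult_field_Aut:
  "\<alpha> \<in> carrier (field_Aut L E) \<Longrightarrow> \<tau> \<in> carrier (field_Aut L E) \<Longrightarrow>
    \<alpha> \<otimes>\<^bsub>field_Aut L E\<^esub> \<tau> = compose (carrier L) \<alpha> \<tau>"
  by (simp add: field_Aut_def BijGroup_def)

lemma field_Aut_mult_closed:
  assumes "E \<subseteq> carrier L"
    "\<And>x y. x \<in> carrier L \<Longrightarrow> y \<in> carrier L \<Longrightarrow> x \<otimes>\<^bsub>L\<^esub> y \<in> carrier L \<and> x \<oplus>\<^bsub>L\<^esub> y \<in> carrier L"
    "\<one>\<^bsub>L\<^esub> \<in> carrier L"
    and \<alpha>: "\<alpha> \<in> carrier (field_Aut L E)" and \<tau>: "\<tau> \<in> carrier (field_Aut L E)"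
  shows "\<alpha> \<otimes>\<^bsub>field_Aut L E\<^esub> \<tau> \<in> carrier (field_Aut L E)"
proof -
  have h: "\<alpha> \<in> ring_hom L L" "\<tau> \<in> ring_hom L L"
    using \<alpha> \<tau> by (auto simp: carrier_field_Aut)
  have "compose (carrier L) \<alpha> \<tau> \<in> ring_hom L L"
    using assms(2,3) ring_hom_memE[OF h(1)] ring_hom_memE[OF h(2)]
    by (intro ring_hom_memI) (auto simp: compose_def)
  moreover have "compose (carrier L) \<alpha> \<tau> \<in> Bij (carrier L)"
    using \<alpha> \<tau> by (auto simp: carrier_field_Aut intro: compose_Bij)
  moreover have "compose (carrier L) \<alpha> \<tau> x = x" if "x \<in> E" for x
    using that \<alpha> \<tau> assms(1) by (auto simp: carrier_field_Aut compose_def)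
  ultimately show ?thesis
    by (simp add: mult_field_Aut[OF \<alpha> \<tau>]) (simp add: carrier_field_Aut)
qed

text \<open>Finiteness of the extension enters through these assumptions: a spanning list, and for
  each element a rational polynomial killing it. Finiteness of the root set stands in for the
  polynomial being nonzero.\<close>

locale number_field_cohesive_power = computable_field_cohesive A C for A (structure) and C +
  fixes Us :: "nat list"
  assumes Us: "set Us \<subseteq> carrier A"
    and spanning: "x \<in> carrier A \<Longrightarrow> \<exists>Ks. set Ks \<subseteq> prime_subfield A \<and> combine Ks Us = x"
    and finite_conjugates: "x \<in> carrier A \<Longrightarrow>
      \<exists>p. set p \<subseteq> prime_subfield A \<and> eval p x = \<zero> \<and> finite {y \<in> carrier A. eval p y = \<zero>}"
begin

section \<open>Computable coordinates over the rationals\<close>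

abbreviation "Q \<equiv> prime_subfield A"
abbreviation "QP \<equiv> cohesive_power_sub C A Q"

text \<open>A single number \<open>z\<close> codes the whole coordinate vector by nested pairing,
  each entry selecting a rational through \<open>prime_enum\<close>. Coordinates can thus be the
  values of one partial function.\<close>

primrec lin_enum :: "nat list \<Rightarrow> nat \<Rightarrow> nat" where
  "lin_enum [] z = \<zero>"
| "lin_enum (v # Vs) z =
    prime_enum (fst (prod_decode z)) \<otimes> v \<oplus> lin_enum Vs (snd (prod_decode z))"

lemma prime_enum_closed [simp]: "prime_enum z \<in> carrier A"
  using range_prime_enum prime_subfield_closed by blast

lemma lin_enum_closed: "set Vs \<subseteq> carrier A \<Longrightarrow> lin_enum Vs z \<in> carrier A"
  by (induction Vs arbitrary: z) auto

lemma recursive_lin_enum: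
  "set Vs \<subseteq> carrier A \<Longrightarrow> recursive n f \<Longrightarrow> recursive n (\<lambda>xs. lin_enum Vs (f xs))"
proof (induction Vs arbitrary: f)
  case (Cons v Vs)
  then have "recursive n (\<lambda>xs. add0 (mult0 (prime_enum (fst (prod_decode (f xs)))) v)
      (lin_enum Vs (snd (prod_decode (f xs)))))"
    by (intro recursive_add0 recursive_mult0 recursive_prime_enum Cons.IH recursive_prod_decode
      recursive_const) auto
  then show ?case
    using Cons.prems by (simp add: add0_def mult0_def lin_enum_closed)
qed (simp add: recursive_const)

lemma lin_enum_combine: "set Ks \<subseteq> Q \<Longrightarrow> set Vs \<subseteq> carrier A \<Longrightarrow> \<exists>z. lin_enum Vs z = combine Ks Vs"
proof (induction Vs arbitrary: Ks)
  case (Cons v Vs)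
  \<comment> \<open>The list \<open>Ks\<close> may be shorter than the list of vectors; it is then
    padded with \<zero>, matching the convention of \<open>combine\<close>.\<close>
  obtain k Ks' where k: "k \<in> Q" "set Ks' \<subseteq> Q" "combine Ks (v # Vs) = k \<otimes> v \<oplus> combine Ks' Vs"
  proof (cases Ks)
    case Nil
    then show ?thesis using that[of \<zero> "[]"] Cons.prems by (simp add: zero_prime_subfield)
  next
    case (Cons k Ks')
    then show ?thesis using that[of k Ks'] \<open>set Ks \<subseteq> Q\<close> by simp
  qed
  from Cons.IH[OF k(2)] Cons.prems obtain z where z: "lin_enum Vs z = combine Ks' Vs" by auto
  from k(1) obtain w where "k = prime_enum w" using range_prime_enum by blast
  then have "lin_enum (v # Vs) (prod_encode (w, z)) = combine Ks (v # Vs)"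
    by (simp add: k(3) z)
  then show ?case ..
qed auto

lemma lin_enum_surj: "x \<in> carrier A \<Longrightarrow> \<exists>z. lin_enum Us z = x"
  using spanning[of x] lin_enum_combine[OF _ Us] by metis

text \<open>The coordinates are rational and hence fixed by \<alpha>, so \<alpha> moves only the
  vectors and keeps the code \<open>z\<close>.\<close>

lemma lin_enum_hom:
  assumes "\<alpha> \<in> ring_hom A A" "\<And>x. x \<in> Q \<Longrightarrow> \<alpha> x = x" "set Vs \<subseteq> carrier A"
  shows "\<alpha> (lin_enum Vs z) = lin_enum (map \<alpha> Vs) z"
  using assms(3)
proof (induction Vs arbitrary: z)
  case Nil
  then show ?case using assms(2) zero_prime_subfield by simp
next
  case (Cons v Vs)
  have "prime_enum w \<in> Q" for w using range_prime_enum by blast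
  with Cons assms(1,2) show ?case
    by (simp add: ring_hom_memE lin_enum_closed)
qed

text \<open>Coordinates need not be unique, so the least code is taken. Off the carrier the search
  stops at 0, which makes the function total.\<close>

definition lin_index :: "nat list \<Rightarrow> nat \<Rightarrow> nat" where
  "lin_index Vs x = (LEAST z. x \<notin> carrier A \<or> lin_enum Vs z = x)"

context
  fixes Vs :: "nat list"
  assumes Vs: "set Vs \<subseteq> carrier A" and surj: "\<And>x. x \<in> carrier A \<Longrightarrow> \<exists>z. lin_enum Vs z = x"
begin

lemma recursive_lin_index: "recursive n f \<Longrightarrow> recursive n (\<lambda>xs. lin_index Vs (f xs))"
  unfolding lin_index_def
  by (intro recursive_Least decidable_disj decidable_not decidable_mem computable_carrier
    decidable_eq recursive_lin_enum Vs recursive_hd)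
     (use surj in \<open>auto intro: recursive_tl\<close>)

lemma lin_enum_index: "x \<in> carrier A \<Longrightarrow> lin_enum Vs (lin_index Vs x) = x"
  unfolding lin_index_def using LeastI_ex[of "\<lambda>z. x \<notin> carrier A \<or> lin_enum Vs z = x"] surj[of x]
    by auto

text \<open>Reading coordinates over \<open>Vs\<close> and recombining them over \<open>Ws\<close>
  is computable. The spanning list and its image, in the two possible orders, give an automorphism
  and its inverse.\<close>

lemma map_lin_fn:
  assumes "\<phi> \<in> fn" "set Ws \<subseteq> carrier A"
    and "\<And>x. x \<in> carrier A \<Longrightarrow> g x = lin_enum Ws (lin_index Vs x)"
  shows "map_partial g \<phi> \<in> fn"
proof -
  have "map_partial (\<lambda>x. lin_enum Ws (lin_index Vs x)) \<phi> \<in> fn"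
    using assms(1,2)
    by (intro map_partial_fn fn_almost_total recursive_lin_enum recursive_lin_index recursive_hd)
      (auto simp: lin_enum_closed)
  also have "map_partial (\<lambda>x. lin_enum Ws (lin_index Vs x)) \<phi> = map_partial g \<phi>"
    using assms(3) ran_fn[OF assms(1)] by (intro map_partial_cong) auto
  finally show ?thesis .
qed

end

section \<open>Lifting automorphisms of the field to the cohesive power\<close>

context
  fixes \<alpha> assumes \<alpha>: "\<alpha> \<in> carrier (field_Aut A Q)"
begin

lemma aut_hom: "\<alpha> \<in> ring_hom A A" and aut_fix: "x \<in> Q \<Longrightarrow> \<alpha> x = x"
  and aut_bij: "bij_betw \<alpha> (carrier A) (carrier A)" and aut_ext: "\<alpha> \<in> extensional (carrier A)"
  using \<alpha> by (auto simp: carrier_field_Aut Bij_def)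

lemma aut_closed: "x \<in> carrier A \<Longrightarrow> \<alpha> x \<in> carrier A"
  using ring_hom_memE(1)[OF aut_hom] .

lemma map_aut_basis: "set (map \<alpha> Us) \<subseteq> carrier A"
  using Us aut_closed by auto

text \<open>On the carrier \<alpha> reads coordinates over \<open>Us\<close> and recombines them
  over the image of \<open>Us\<close>.\<close>

lemma map_aut_fn: "\<phi> \<in> fn \<Longrightarrow> map_partial \<alpha> \<phi> \<in> fn"
  using lin_enum_hom[OF aut_hom aut_fix Us] lin_enum_index[OF Us lin_enum_surj]
  by (intro map_lin_fn[OF Us lin_enum_surj _ map_aut_basis]) metis+

lemma lin_enum_map_aut_surj:
  assumes "x \<in> carrier A"
  shows "\<exists>z. lin_enum (map \<alpha> Us) z = x"
proof -
  have "x \<in> \<alpha> ` carrier A"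
    using assms aut_bij by (simp add: bij_betw_def)
  then obtain y where y: "y \<in> carrier A" "\<alpha> y = x"
    by auto
  from lin_enum_surj[OF y(1)] obtain z where "lin_enum Us z = y" ..
  with y show ?thesis
    using lin_enum_hom[OF aut_hom aut_fix Us] by metis
qed

text \<open>The roles are exchanged: coordinates are read over the image of \<open>Us\<close>, which
  spans because \<alpha> is onto, and recombined over \<open>Us\<close>.\<close>

lemma map_inv_aut_fn: "\<phi> \<in> fn \<Longrightarrow> map_partial (inv_into (carrier A) \<alpha>) \<phi> \<in> fn"
proof (rule map_lin_fn[OF map_aut_basis lin_enum_map_aut_surj _ Us])
  fix x assume x: "x \<in> carrier A"
  have "\<alpha> (lin_enum Us (lin_index (map \<alpha> Us) x)) = x"
    using lin_enum_index[OF map_aut_basis lin_enum_map_aut_surj x]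
      lin_enum_hom[OF aut_hom aut_fix Us] by metis
  then show "inv_into (carrier A) \<alpha> x = lin_enum Us (lin_index (map \<alpha> Us) x)"
    using bij_betw_inv_into_left[OF aut_bij lin_enum_closed[OF Us]] by metis
qed

end

definition lift_aut :: "(nat \<Rightarrow> nat) \<Rightarrow> (nat \<rightharpoonup> nat) set \<Rightarrow> (nat \<rightharpoonup> nat) set" where
  "lift_aut \<alpha> = (\<lambda>U\<in>carrier P. \<Union>\<phi>\<in>U. cl (map_partial \<alpha> \<phi>))"

lemma agree_map: "agree C \<phi> \<psi> \<Longrightarrow> agree C (map_partial g \<phi>) (map_partial g \<psi>)"
  unfolding agree_def by (erule almost_subset_trans) (auto simp: map_partial_def)

lemma lift_aut_cl:
  assumes \<alpha>: "\<alpha> \<in> carrier (field_Aut A Q)" and \<phi>: "\<phi> \<in> fn"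
  shows "lift_aut \<alpha> (cl \<phi>) = cl (map_partial \<alpha> \<phi>)"
proof -
  have "cl (map_partial \<alpha> \<psi>) = cl (map_partial \<alpha> \<phi>)" if "\<psi> \<in> cl \<phi>" for \<psi>
  proof -
    have "agree C (map_partial \<alpha> \<psi>) (map_partial \<alpha> \<phi>)"
      using that \<phi> by (auto simp: mem_cl_iff cl_eq_iff intro: agree_map)
    with that \<phi> show ?thesis
      by (simp add: cl_eq_iff map_aut_fn[OF \<alpha>] mem_cl_iff)
  qed
  moreover have "\<phi> \<in> cl \<phi>" using \<phi> by (simp add: mem_cl_iff)
  ultimately have "(\<Union>\<psi>\<in>cl \<phi>. cl (map_partial \<alpha> \<psi>)) = cl (map_partial \<alpha> \<phi>)"
    by blast
  with \<phi> show ?thesis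
    by (simp add: lift_aut_def carrier_P)
qed

lemma lift_aut_emb: "\<alpha> \<in> carrier (field_Aut A Q) \<Longrightarrow> a \<in> carrier A \<Longrightarrow> lift_aut \<alpha> (emb a) = emb (\<alpha> a)"
  by (simp add: emb_def lift_aut_cl const_fn)

text \<open>Composition with \<alpha> respects the pointwise operations. Injectivity of \<alpha>
  reflects agreement, and composition with the computable inverse provides preimages.\<close>

lemma lift_aut_carrier:
  assumes \<alpha>: "\<alpha> \<in> carrier (field_Aut A Q)"
  shows "lift_aut \<alpha> \<in> carrier (field_Aut P QP)"
  unfolding carrier_field_Aut
proof (intro conjI ballI)
  note hom = ring_hom_memE[OF aut_hom[OF \<alpha>]]
  show "lift_aut \<alpha> \<in> ring_hom P P"
  proof (rule ring_hom_memI)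
    fix U V assume "U \<in> carrier P" "V \<in> carrier P"
    then obtain \<phi> \<psi> where \<phi>: "\<phi> \<in> fn" "U = cl \<phi>" and \<psi>: "\<psi> \<in> fn" "V = cl \<psi>"
      by (auto simp: carrier_P)
    show "lift_aut \<alpha> (U \<otimes>\<^bsub>P\<^esub> V) = lift_aut \<alpha> U \<otimes>\<^bsub>P\<^esub> lift_aut \<alpha> V"
      using map_partial_pointwise[where g = \<alpha> and f = "(\<otimes>)"
        and S = "carrier A", OF hom(2) ran_fn[OF \<phi>(1)] ran_fn[OF \<psi>(1)]] \<phi> \<psi>
      by (simp add: cl_mult lift_aut_cl[OF \<alpha>] mult_fn map_aut_fn[OF \<alpha>])
    show "lift_aut \<alpha> (U \<oplus>\<^bsub>P\<^esub> V) = lift_aut \<alpha> U \<oplus>\<^bsub>P\<^esub> lift_aut \<alpha> V"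
      using map_partial_pointwise[where g = \<alpha> and f = "(\<oplus>)"
        and S = "carrier A", OF hom(3) ran_fn[OF \<phi>(1)] ran_fn[OF \<psi>(1)]] \<phi> \<psi>
      by (simp add: cl_add lift_aut_cl[OF \<alpha>] add_fn map_aut_fn[OF \<alpha>])
  qed (auto simp: carrier_P lift_aut_cl[OF \<alpha>] map_aut_fn[OF \<alpha>] one_P const_fn hom(4))
  have inj: "inj_on (lift_aut \<alpha>) (carrier P)"
  proof (rule inj_onI)
    fix U V assume "U \<in> carrier P" "V \<in> carrier P" and eq: "lift_aut \<alpha> U = lift_aut \<alpha> V"
    then obtain \<phi> \<psi> where \<phi>: "\<phi> \<in> fn" "U = cl \<phi>" and \<psi>: "\<psi> \<in> fn" "V = cl \<psi>"
      by (auto simp: carrier_P)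
    from eq have "agree C (map_partial \<alpha> \<phi>) (map_partial \<alpha> \<psi>)"
      by (simp add: \<phi> \<psi> lift_aut_cl[OF \<alpha>] map_aut_fn[OF \<alpha>] cl_eq_iff)
    \<comment> \<open>Wherever the images agree, so do the original values; hence agreement on
      almost all of \<open>C\<close> is reflected.\<close>
    moreover have "v = w" if "\<phi> i = Some v" "\<psi> i = Some w" "\<alpha> v = \<alpha> w" for i v w
      using that ran_fn[OF \<phi>(1)] ran_fn[OF \<psi>(1)] aut_bij[OF \<alpha>]
      by (auto simp: bij_betw_def inj_on_def ran_def)
    ultimately have "agree C \<phi> \<psi>"
      unfolding agree_def by (elim almost_subset_trans) (force simp: map_partial_def)
    then show "U = V" by (simp add: \<phi> \<psi> cl_eq_iff)
  qed
  have "U \<in> lift_aut \<alpha> ` carrier P" if "U \<in> carrier P" for U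
  proof -
    from that obtain \<phi> where \<phi>: "\<phi> \<in> fn" "U = cl \<phi>" by (auto simp: carrier_P)
    let ?\<psi> = "map_partial (inv_into (carrier A) \<alpha>) \<phi>"
    have "map_partial \<alpha> ?\<psi> = map_partial (\<lambda>x. x) \<phi>"
      unfolding map_partial_comp using ran_fn[OF \<phi>(1)] aut_bij[OF \<alpha>]
      by (intro map_partial_cong) (auto simp: bij_betw_inv_into_right)
    also have "\<dots> = \<phi>" by (simp add: map_partial_def option.map_ident)
    finally show ?thesis
      using \<phi> map_inv_aut_fn[OF \<alpha> \<phi>(1)] by (force simp: carrier_P lift_aut_cl[OF \<alpha>])
  qed
  moreover have "lift_aut \<alpha> U \<in> carrier P" if "U \<in> carrier P" for U
    using that by (auto simp: carrier_P lift_aut_cl[OF \<alpha>] map_aut_fn[OF \<alpha>])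
  ultimately show "lift_aut \<alpha> \<in> Bij (carrier P)"
    using inj by (auto simp: Bij_def bij_betw_def lift_aut_def)
  show "lift_aut \<alpha> U = U" if U: "U \<in> QP" for U
  proof -
    from U obtain \<phi> where \<phi>: "\<phi> \<in> U" "ran \<phi> \<subseteq> Q" "U \<in> carrier P"
      by (auto simp: cohesive_power_sub_def)
    then have "\<phi> \<in> fn" "U = cl \<phi>" by (auto simp: carrier_P mem_cl_iff)
    \<comment> \<open>A class in \<open>QP\<close> has a representative with rational values only,
      which \<alpha> leaves unchanged.\<close>
    moreover have "map_partial \<alpha> \<phi> = map_partial (\<lambda>x. x) \<phi>"
      using \<phi>(2) aut_fix[OF \<alpha>] by (intro map_partial_cong) auto
    moreover have "map_partial (\<lambda>x. x) \<phi> = \<phi>" by (simp add: map_partial_def option.map_ident)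
    ultimately show ?thesis by (simp add: lift_aut_cl[OF \<alpha>])
  qed
qed

lemma lift_aut_mult:
  assumes \<alpha>: "\<alpha> \<in> carrier (field_Aut A Q)" and \<tau>: "\<tau> \<in> carrier (field_Aut A Q)"
    and \<alpha>\<tau>: "\<alpha> \<otimes>\<^bsub>field_Aut A Q\<^esub> \<tau> \<in> carrier (field_Aut A Q)"
  shows "lift_aut (\<alpha> \<otimes>\<^bsub>field_Aut A Q\<^esub> \<tau>) = lift_aut \<alpha> \<otimes>\<^bsub>field_Aut P QP\<^esub> lift_aut \<tau>"
proof -
  have "lift_aut (\<alpha> \<otimes>\<^bsub>field_Aut A Q\<^esub> \<tau>) U = compose (carrier P) (lift_aut \<alpha>) (lift_aut \<tau>) U" for U
  proof (cases "U \<in> carrier P")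
    case True
    then obtain \<phi> where \<phi>: "\<phi> \<in> fn" "U = cl \<phi>" by (auto simp: carrier_P)
    have "map_partial (\<alpha> \<otimes>\<^bsub>field_Aut A Q\<^esub> \<tau>) \<phi> = map_partial (\<lambda>x. \<alpha> (\<tau> x)) \<phi>"
      using ran_fn[OF \<phi>(1)] by (intro map_partial_cong) (auto simp: mult_field_Aut \<alpha> \<tau> compose_def)
    with True \<phi> show ?thesis
      by (simp add: compose_def lift_aut_cl \<alpha> \<tau> \<alpha>\<tau> map_aut_fn map_partial_comp)
  qed (simp add: lift_aut_def compose_def)
  then show ?thesis
    by (simp add: mult_field_Aut lift_aut_carrier \<alpha> \<tau> fun_eq_iff)
qed

section \<open>Restricting automorphisms of the cohesive power to constants\<close>

context
  fixes \<tau> assumes \<tau>: "\<tau> \<in> carrier (field_Aut P QP)"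
begin

lemma ext_aut_hom: "\<tau> \<in> ring_hom P P" and ext_aut_fix: "U \<in> QP \<Longrightarrow> \<tau> U = U"
  and ext_aut_bij: "bij_betw \<tau> (carrier P) (carrier P)"
    and ext_aut_ext: "\<tau> \<in> extensional (carrier P)"
  using \<tau> by (auto simp: carrier_field_Aut Bij_def)

lemmas ext_aut_closed = ring_hom_memE(1)[OF ext_aut_hom]
  and ext_aut_mult = ring_hom_memE(2)[OF ext_aut_hom]
  and ext_aut_add = ring_hom_memE(3)[OF ext_aut_hom]
  and ext_aut_one = ring_hom_memE(4)[OF ext_aut_hom]

lemma ext_aut_emb_mult:
  "a \<in> carrier A \<Longrightarrow> b \<in> carrier A \<Longrightarrow> \<tau> (emb (a \<otimes> b)) = \<tau> (emb a) \<otimes>\<^bsub>P\<^esub> \<tau> (emb b)"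
  by (simp add: emb_mult ext_aut_mult emb_closed)

lemma ext_aut_emb_add:
  "a \<in> carrier A \<Longrightarrow> b \<in> carrier A \<Longrightarrow> \<tau> (emb (a \<oplus> b)) = \<tau> (emb a) \<oplus>\<^bsub>P\<^esub> \<tau> (emb b)"
  by (simp add: emb_add ext_aut_add emb_closed)

lemma ext_aut_emb_Q: "q \<in> Q \<Longrightarrow> \<tau> (emb q) = emb q"
  by (rule ext_aut_fix) (simp add: emb_mem_sub prime_subfield_closed)

context
  fixes a \<phi> assumes a: "a \<in> carrier A" and \<phi>: "\<phi> \<in> fn" and ext_aut_a: "\<tau> (emb a) = cl \<phi>"
begin

lemma ext_aut_power:
  "map_partial (\<lambda>x. x [^] k) \<phi> \<in> fn \<and> \<tau> (emb (a [^] k)) = cl (map_partial (\<lambda>x. x [^] (k::nat)) \<phi>)"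
proof (induction k)
  case 0
  then show ?case
    using fn_almost_total[OF \<phi>] by (simp add: map_partial_const_fn cl_map_const emb_one ext_aut_one)
next
  case (Suc k)
  have "map_partial (\<lambda>x. x) \<phi> = \<phi>" by (simp add: map_partial_def option.map_ident)
  then show ?case
    using cl_map_mult[of "\<lambda>x. x [^] k" \<phi> "\<lambda>x. x"] Suc \<phi> a ext_aut_a
    by (simp add: emb_mult ext_aut_mult emb_closed)
qed

text \<open>Since \<tau> fixes rational constants, it carries the value of a rational polynomial at
  the constant class of \<open>a\<close> to the class obtained by evaluating along \<phi>. A root
  thus goes to a class of roots.\<close>

lemma ext_aut_eval:
  "set p \<subseteq> Q \<Longrightarrow> map_partial (eval p) \<phi> \<in> fn \<and> \<tau> (emb (eval p a)) = cl (map_partial (eval p) \<phi>)"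
proof (induction p)
  case Nil
  then show ?case
    using fn_almost_total[OF \<phi>] ext_aut_emb_Q[OF zero_prime_subfield]
    by (simp add: map_partial_const_fn cl_map_const)
next
  case (Cons q p)
  then have q: "q \<in> Q" "q \<in> carrier A" and p: "set p \<subseteq> carrier A"
    by (auto simp: prime_subfield_closed)
  note at = fn_almost_total[OF \<phi>]
  \<comment> \<open>Coefficient lists start with the leading coefficient, so the head
    \<open>q\<close> belongs to the power \<open>length p\<close>.\<close>
  note qk = cl_map_mult[OF map_partial_const_fn[OF at q(2)]
    conjunct1[OF ext_aut_power[of "length p"]]]
  note sum = cl_map_add[OF qk(1) conjunct1[OF Cons.IH]]
  from Cons.prems have "set p \<subseteq> Q" by simp
  then show ?case
    using sum qk Cons.IH ext_aut_power[of "length p"] q p a at eval_in_carrier[OF p a]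
    by (simp add: ext_aut_emb_add ext_aut_emb_mult ext_aut_emb_Q cl_map_const)
qed

end

text \<open>Here cohesiveness is decisive: a function taking finitely many values on almost all of
  \<open>C\<close> is almost constant there.\<close>

lemma ext_aut_emb:
  assumes "a \<in> carrier A"
  shows "\<exists>b\<in>carrier A. \<tau> (emb a) = emb b"
proof -
  obtain \<phi> where \<phi>: "\<phi> \<in> fn" "\<tau> (emb a) = cl \<phi>"
    using ext_aut_closed[OF emb_closed[OF assms]] by (auto simp: carrier_P)
  obtain p where p: "set p \<subseteq> Q" "eval p a = \<zero>" and fin: "finite {y \<in> carrier A. eval p y = \<zero>}"
    using finite_conjugates[OF assms] by auto
  let ?R = "{y \<in> carrier A. eval p y = \<zero>}"
  note ev = ext_aut_eval[OF assms \<phi> p(1)]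
  have "cl (map_partial (eval p) \<phi>) = cl (\<lambda>_. Some \<zero>)"
    using ev p(2) ext_aut_emb_Q[OF zero_prime_subfield] by (simp add: emb_def)
  with ev have "agree C (map_partial (eval p) \<phi>) (\<lambda>_. Some \<zero>)"
    by (simp add: cl_eq_iff const_fn)
  \<comment> \<open>The value of \<phi> is a root of \<open>p\<close> at almost every point of
    \<open>C\<close>, so the fibers over the finitely many roots almost cover
    \<open>C\<close>.\<close>
  then have "C \<subseteq>* (\<Union>r\<in>?R. {i. \<phi> i = Some r})"
    unfolding agree_def
    by (rule almost_subset_trans) (use ran_fn[OF \<phi>(1)] in \<open>auto simp: map_partial_def ran_def\<close>)
  then obtain r where r: "r \<in> ?R" "C \<subseteq>* {i. \<phi> i = Some r}"
    using cohesive_finite_Union[OF cohesive fin, of "\<lambda>r. {i. \<phi> i = Some r}"] \<phi>(1)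
    by (auto simp: cp_functions_def ce_fiber)
  then have "agree C \<phi> (\<lambda>_. Some r)"
    unfolding agree_def by (auto elim: almost_subset_trans)
  with r(1) \<phi> show ?thesis
    by (auto simp: emb_def cl_eq_iff const_fn)
qed

text \<open>The choice is unique because \<open>emb\<close> is injective on the carrier.\<close>

definition restrict_aut :: "nat \<Rightarrow> nat" where
  "restrict_aut = (\<lambda>a\<in>carrier A. SOME b. b \<in> carrier A \<and> \<tau> (emb a) = emb b)"

lemma restrict_aut:
  assumes "a \<in> carrier A"
  shows "restrict_aut a \<in> carrier A" "\<tau> (emb a) = emb (restrict_aut a)"
proof -
  have "\<exists>b. b \<in> carrier A \<and> \<tau> (emb a) = emb b"
    using ext_aut_emb[OF assms] by auto
  from someI_ex[OF this] show "restrict_aut a \<in> carrier A" "\<tau> (emb a) = emb (restrict_aut a)"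
    using assms by (simp_all add: restrict_aut_def)
qed

lemma restrict_aut_eqI:
  "a \<in> carrier A \<Longrightarrow> b \<in> carrier A \<Longrightarrow> \<tau> (emb a) = emb b \<Longrightarrow> restrict_aut a = b"
  using restrict_aut[of a] emb_eq_iff by simp

lemma restrict_aut_hom: "restrict_aut \<in> ring_hom A A"
proof (rule ring_hom_memI)
  fix a b assume ab: "a \<in> carrier A" "b \<in> carrier A"
  then show "restrict_aut (a \<otimes> b) = restrict_aut a \<otimes> restrict_aut b"
    by (intro restrict_aut_eqI) (simp_all add: restrict_aut emb_mult ext_aut_mult emb_closed)
  from ab show "restrict_aut (a \<oplus> b) = restrict_aut a \<oplus> restrict_aut b"
    by (intro restrict_aut_eqI) (simp_all add: restrict_aut emb_add ext_aut_add emb_closed)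
qed (auto intro!: restrict_aut_eqI simp: restrict_aut emb_one ext_aut_one)

lemma restrict_aut_Q: "q \<in> Q \<Longrightarrow> restrict_aut q = q"
  by (intro restrict_aut_eqI) (simp_all add: ext_aut_emb_Q prime_subfield_closed)

lemma restrict_aut_inj: "inj_on restrict_aut (carrier A)"
proof (rule inj_onI)
  fix a b assume ab: "a \<in> carrier A" "b \<in> carrier A" "restrict_aut a = restrict_aut b"
  then have "\<tau> (emb a) = \<tau> (emb b)" by (simp add: restrict_aut)
  with ab show "a = b"
    using ext_aut_bij inj_onD[of \<tau> "carrier P" "emb a" "emb b"]
    by (simp add: bij_betw_def emb_closed emb_eq_iff)
qed

lemma restrict_aut_eval:
  "set p \<subseteq> Q \<Longrightarrow> a \<in> carrier A \<Longrightarrow> restrict_aut (eval p a) = eval p (restrict_aut a)"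
proof -
  assume p: "set p \<subseteq> Q" and a: "a \<in> carrier A"
  interpret h: ring_hom_ring A A restrict_aut
    by (rule ring_hom_ringI2[OF ring_axioms ring_axioms restrict_aut_hom])
  have "map restrict_aut p = p"
    using p restrict_aut_Q by (intro map_idI) auto
  moreover have "set p \<subseteq> carrier A"
    using p prime_subfield_closed by auto
  ultimately show ?thesis
    using h.eval_hom'[OF a, of p] by simp
qed

text \<open>An injective endomorphism permutes the finite set of roots of each rational polynomial.\<close>

lemma restrict_aut_surj: "restrict_aut ` carrier A = carrier A"
proof
  show "carrier A \<subseteq> restrict_aut ` carrier A"
  proof
    fix b assume b: "b \<in> carrier A"
    obtain p where p: "set p \<subseteq> Q" "eval p b = \<zero>" and fin: "finite {y \<in> carrier A. eval p y = \<zero>}"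
      using finite_conjugates[OF b] by auto
    let ?R = "{y \<in> carrier A. eval p y = \<zero>}"
    have "restrict_aut ` ?R \<subseteq> ?R"
      using restrict_aut_eval[OF p(1)] restrict_aut(1) restrict_aut_Q[OF zero_prime_subfield]
        by force
    then have "restrict_aut ` ?R = ?R"
      using fin restrict_aut_inj by (intro endo_inj_surj) (auto intro: inj_on_subset)
    moreover have "b \<in> ?R" using b p(2) by simp
    ultimately show "b \<in> restrict_aut ` carrier A" by blast
  qed
qed (use restrict_aut in auto)

lemma restrict_aut_carrier: "restrict_aut \<in> carrier (field_Aut A Q)"
  unfolding carrier_field_Aut
  by (auto simp: restrict_aut_hom restrict_aut_Q Bij_def bij_betw_def restrict_aut_inj
      restrict_aut_surj) (simp add: restrict_aut_def)

text \<open>Rational coefficient classes are fixed by \<tau>, while the constants of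
  \<open>Vs\<close> move by \<open>restrict_aut\<close>. The function \<open>g\<close> varies
  because the induction descends through the nested pairing of the coordinate code.\<close>

lemma ext_aut_lin_enum:
  assumes \<zeta>: "\<zeta> \<in> almost_total"
  shows "set Vs \<subseteq> carrier A \<Longrightarrow> recursive 1 (\<lambda>xs. g (hd xs)) \<Longrightarrow>
    \<tau> (cl (map_partial (\<lambda>z. lin_enum Vs (g z)) \<zeta>)) =
      cl (map_partial (\<lambda>z. lin_enum (map restrict_aut Vs) (g z)) \<zeta>)"
proof (induction Vs arbitrary: g)
  case Nil
  then show ?case
    using \<zeta> ext_aut_emb_Q[OF zero_prime_subfield] by (simp add: cl_map_const)
next
  case (Cons v Vs)
  let ?q = "map_partial (\<lambda>z. prime_enum (fst (prod_decode (g z)))) \<zeta>"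
  let ?w = "restrict_aut v"
  let ?L = "\<lambda>Vs. map_partial (\<lambda>z. lin_enum Vs (snd (prod_decode (g z)))) \<zeta>"
  have v: "v \<in> carrier A" "?w \<in> carrier A" and Vs: "set Vs \<subseteq> carrier A"
    "set (map restrict_aut Vs) \<subseteq> carrier A"
    using Cons.prems restrict_aut(1) by auto
  have q: "?q \<in> fn"
    by (intro map_partial_fn[OF \<zeta>] recursive_prime_enum recursive_prod_decode Cons.prems) auto
  have L: "?L Ws \<in> fn" if "set Ws \<subseteq> carrier A" for Ws
    using that
    by (intro map_partial_fn[OF \<zeta>] recursive_lin_enum recursive_prod_decode Cons.prems)
      (auto simp: lin_enum_closed)
  \<comment> \<open>General \<open>u\<close> and \<open>Ws\<close> allow the decomposition to be
    used both for the original vectors and for their images.\<close>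
  have split: "map_partial (\<lambda>z. prime_enum (fst (prod_decode (g z))) \<otimes> u) \<zeta> \<in> fn"
    "cl (map_partial (\<lambda>z. lin_enum (u # Ws) (g z)) \<zeta>) = cl ?q \<otimes>\<^bsub>P\<^esub> emb u \<oplus>\<^bsub>P\<^esub> cl (?L Ws)"
    "cl ?q \<otimes>\<^bsub>P\<^esub> emb u \<in> carrier P"
    if "u \<in> carrier A" "set Ws \<subseteq> carrier A" for u Ws
  proof -
    note m = cl_map_mult[OF q map_partial_const_fn[OF \<zeta> that(1)]]
    show "map_partial (\<lambda>z. prime_enum (fst (prod_decode (g z))) \<otimes> u) \<zeta> \<in> fn"
      by (rule m(1))
    show "cl (map_partial (\<lambda>z. lin_enum (u # Ws) (g z)) \<zeta>) = cl ?q \<otimes>\<^bsub>P\<^esub> emb u \<oplus>\<^bsub>P\<^esub> cl (?L Ws)"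
      using cl_map_add(2)[OF m(1) L[OF that(2)]] m(2) \<zeta> that(1) by (simp add: cl_map_const)
    show "cl ?q \<otimes>\<^bsub>P\<^esub> emb u \<in> carrier P"
      using m \<zeta> that(1) by (auto simp: cl_map_const carrier_P)
  qed
  \<comment> \<open>The coefficient class lies in \<open>QP\<close>: this is where non-constant
    elements fixed by \<tau> are used.\<close>
  have "ran ?q \<subseteq> Q"
    using range_prime_enum by (auto simp: ran_map_partial)
  then have fix_q: "\<tau> (cl ?q) = cl ?q"
    using q by (intro ext_aut_fix cl_mem_sub)
  have "\<tau> (cl (map_partial (\<lambda>z. lin_enum (v # Vs) (g z)) \<zeta>)) =
      \<tau> (cl ?q \<otimes>\<^bsub>P\<^esub> emb v) \<oplus>\<^bsub>P\<^esub> \<tau> (cl (?L Vs))"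
    unfolding split(2)[OF v(1) Vs(1)]
    using split(3)[OF v(1) Vs(1)] L[OF Vs(1)] by (intro ext_aut_add) (auto simp: carrier_P)
  also have "\<tau> (cl ?q \<otimes>\<^bsub>P\<^esub> emb v) = cl ?q \<otimes>\<^bsub>P\<^esub> emb ?w"
    using q v fix_q restrict_aut(2)[OF v(1)] by (subst ext_aut_mult)
      (auto simp: carrier_P emb_closed[unfolded carrier_P])
  also have "\<tau> (cl (?L Vs)) = cl (?L (map restrict_aut Vs))"
    using Vs by (intro Cons.IH recursive_prod_decode Cons.prems)
  finally show ?case
    using split(2)[OF v(2) Vs(2)] by simp
qed

text \<open>An arbitrary \<phi> is written as a linear combination of the constants
  \<open>Us\<close> with coordinates computed from its values. By \<open>ext_aut_lin_enum\<close>,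
  \<tau> recombines these coordinates over the images, which is composition with
  \<open>restrict_aut\<close>.\<close>

lemma lift_restrict_aut: "lift_aut restrict_aut = \<tau>"
proof
  fix U
  show "lift_aut restrict_aut U = \<tau> U"
  proof (cases "U \<in> carrier P")
    case True
    then obtain \<phi> where \<phi>: "\<phi> \<in> fn" "U = cl \<phi>" by (auto simp: carrier_P)
    let ?\<zeta> = "map_partial (lin_index Us) \<phi>"
    have \<zeta>: "?\<zeta> \<in> almost_total"
      by (intro map_partial_almost_total fn_almost_total \<phi> recursive_lin_index Us lin_enum_surj
        recursive_hd) auto
    have inv: "lin_enum Us (lin_index Us x) = x" if "x \<in> ran \<phi>" for x
      using that ran_fn[OF \<phi>(1)] lin_enum_index[OF Us lin_enum_surj] by auto
    have "map_partial (\<lambda>z. lin_enum Us z) ?\<zeta> = map_partial (\<lambda>x. x) \<phi>"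
      unfolding map_partial_comp by (intro map_partial_cong inv)
    moreover have
      "map_partial (\<lambda>z. lin_enum (map restrict_aut Us) z) ?\<zeta> = map_partial restrict_aut \<phi>"
      unfolding map_partial_comp
      by (intro map_partial_cong) (metis inv lin_enum_hom[OF restrict_aut_hom restrict_aut_Q Us])
    moreover have "map_partial (\<lambda>x. x) \<phi> = \<phi>"
      by (simp add: map_partial_def option.map_ident)
    ultimately have "\<tau> (cl \<phi>) = cl (map_partial restrict_aut \<phi>)"
      using ext_aut_lin_enum[OF \<zeta> Us, of "\<lambda>z. z"] recursive_hd[of 1] by simp
    then show ?thesis
      by (simp add: \<phi> lift_aut_cl[OF restrict_aut_carrier])
  qed (use ext_aut_ext in \<open>auto simp: lift_aut_def extensional_def\<close>)
qed

end

text \<open>The isomorphism is \<open>lift_aut\<close>, taken in the reverse direction. Injectivity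
  is seen on constants, and surjectivity comes from restricting and lifting back.\<close>

theorem field_Aut_cohesive_power: "field_Aut P QP \<cong> field_Aut A Q"
proof (rule iso_sym_magma)
  have closed: "\<alpha> \<otimes>\<^bsub>field_Aut A Q\<^esub> \<tau> \<in> carrier (field_Aut A Q)"
    if "\<alpha> \<in> carrier (field_Aut A Q)" "\<tau> \<in> carrier (field_Aut A Q)" for \<alpha> \<tau>
    using that prime_subfield_closed by (intro field_Aut_mult_closed) auto
  then show "\<alpha> \<otimes>\<^bsub>field_Aut A Q\<^esub> \<tau> \<in> carrier (field_Aut A Q)"
    if "\<alpha> \<in> carrier (field_Aut A Q)" "\<tau> \<in> carrier (field_Aut A Q)" for \<alpha> \<tau>
    using that .
  have "lift_aut \<in> hom (field_Aut A Q) (field_Aut P QP)"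
    using closed by (intro homI lift_aut_carrier lift_aut_mult)
  moreover have "inj_on lift_aut (carrier (field_Aut A Q))"
  proof (rule inj_onI)
    fix \<alpha> \<beta> assume a: "\<alpha> \<in> carrier (field_Aut A Q)" and b: "\<beta> \<in> carrier (field_Aut A Q)"
      and eq: "lift_aut \<alpha> = lift_aut \<beta>"
    show "\<alpha> = \<beta>"
    proof (rule extensionalityI[OF aut_ext[OF a] aut_ext[OF b]])
      fix x assume x: "x \<in> carrier A"
      then have "emb (\<alpha> x) = emb (\<beta> x)"
        using eq lift_aut_emb[OF a x] lift_aut_emb[OF b x] by simp
      then show "\<alpha> x = \<beta> x"
        using x by (simp add: emb_eq_iff aut_closed[OF a] aut_closed[OF b])
    qed
  qed
  moreover have "carrier (field_Aut P QP) \<subseteq> lift_aut ` carrier (field_Aut A Q)"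
    using lift_restrict_aut restrict_aut_carrier by (metis image_eqI subsetI)
  ultimately show "lift_aut \<in> Group.iso (field_Aut A Q) (field_Aut P QP)"
    by (auto simp: Group.iso_def bij_betw_def lift_aut_carrier)
qed

end

section \<open>Transport along ring isomorphisms\<close>

lemma field_Aut_ring_iso:
  assumes h: "h \<in> ring_iso L M" and E: "E \<subseteq> carrier L" "h ` E = F" and "ring L"
  shows "field_Aut L E \<cong> field_Aut M F"
proof -
  interpret L: ring L by fact
  define k where "k = inv_into (carrier L) h"
  have hb: "bij_betw h (carrier L) (carrier M)" and hom: "h \<in> ring_hom L M"
    using h by (auto simp: ring_iso_def)
  then have kb: "bij_betw k (carrier M) (carrier L)"
    unfolding k_def by (simp add: bij_betw_inv_into)
  have kh [simp]: "k (h x) = x" if "x \<in> carrier L" for x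
    unfolding k_def using that hb by (simp add: bij_betw_inv_into_left)
  have hk [simp]: "h (k y) = y" if "y \<in> carrier M" for y
    unfolding k_def using that hb by (simp add: bij_betw_inv_into_right)
  have k_closed [simp]: "k y \<in> carrier L" if "y \<in> carrier M" for y
    using that kb by (auto dest: bij_betwE)
  note hm [simp] = ring_hom_memE[OF hom]
  have k_mult: "k (x \<otimes>\<^bsub>M\<^esub> y) = k x \<otimes>\<^bsub>L\<^esub> k y" if "x \<in> carrier M" "y \<in> carrier M" for x y
    using kh[of "k x \<otimes>\<^bsub>L\<^esub> k y"] that by (simp del: kh)
  have k_add: "k (x \<oplus>\<^bsub>M\<^esub> y) = k x \<oplus>\<^bsub>L\<^esub> k y" if "x \<in> carrier M" "y \<in> carrier M" for x y
    using kh[of "k x \<oplus>\<^bsub>L\<^esub> k y"] that by (simp del: kh)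
  have k_one: "k \<one>\<^bsub>M\<^esub> = \<one>\<^bsub>L\<^esub>"
    using kh[of "\<one>\<^bsub>L\<^esub>"] by (simp del: kh)
  \<comment> \<open>Closure of \<open>M\<close> under its operations is inherited from
    \<open>L\<close> through \<open>h\<close>.\<close>
  have M_closed: "x \<otimes>\<^bsub>M\<^esub> y \<in> carrier M \<and> x \<oplus>\<^bsub>M\<^esub> y \<in> carrier M"
    if "x \<in> carrier M" "y \<in> carrier M" for x y
    using hm(1)[of "k x \<otimes>\<^bsub>L\<^esub> k y"] hm(1)[of "k x \<oplus>\<^bsub>L\<^esub> k y"] that by simp
  have M_one: "\<one>\<^bsub>M\<^esub> \<in> carrier M"
    using hm(1)[of "\<one>\<^bsub>L\<^esub>"] by simp
  have kE: "k y \<in> E" if "y \<in> F" for y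
    using that E kh by auto
  have F: "F \<subseteq> carrier M"
    using E by auto
  \<comment> \<open>Conjugation by \<open>h\<close> in both directions, cut down to extensional
    functions as \<open>Bij\<close> demands.\<close>
  let ?c = "\<lambda>\<sigma>. \<lambda>y\<in>carrier M. h (\<sigma> (k y))"
  let ?d = "\<lambda>\<rho>. \<lambda>x\<in>carrier L. k (\<rho> (h x))"
  have c: "?c \<sigma> \<in> carrier (field_Aut M F)" if \<sigma>: "\<sigma> \<in> carrier (field_Aut L E)" for \<sigma>
  proof -
    have sh: "\<sigma> \<in> ring_hom L L" and sb: "bij_betw \<sigma> (carrier L) (carrier L)"
      and sE: "\<And>x. x \<in> E \<Longrightarrow> \<sigma> x = x"
      using \<sigma> by (auto simp: carrier_field_Aut Bij_def)
    note [simp] = ring_hom_memE[OF sh]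
    have "bij_betw (h \<circ> (\<sigma> \<circ> k)) (carrier M) (carrier M)"
      by (rule bij_betw_trans[OF bij_betw_trans[OF kb sb] hb])
    then have "?c \<sigma> \<in> Bij (carrier M)"
      by (auto simp: Bij_def comp_def cong: bij_betw_cong)
    moreover have "?c \<sigma> \<in> ring_hom M M"
      by (rule ring_hom_memI) (auto simp: k_mult k_add k_one M_closed M_one)
    moreover have "?c \<sigma> y = y" if "y \<in> F" for y
      using that F sE[OF kE[OF that]] by auto
    ultimately show ?thesis
      by (simp add: carrier_field_Aut)
  qed
  have d: "?d \<rho> \<in> carrier (field_Aut L E)" if \<rho>: "\<rho> \<in> carrier (field_Aut M F)" for \<rho>
  proof -
    have rh: "\<rho> \<in> ring_hom M M" and rb: "bij_betw \<rho> (carrier M) (carrier M)"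
      and rE: "\<And>x. x \<in> F \<Longrightarrow> \<rho> x = x"
      using \<rho> by (auto simp: carrier_field_Aut Bij_def)
    note [simp] = ring_hom_memE[OF rh]
    have "bij_betw (k \<circ> (\<rho> \<circ> h)) (carrier L) (carrier L)"
      by (rule bij_betw_trans[OF bij_betw_trans[OF hb rb] kb])
    then have "?d \<rho> \<in> Bij (carrier L)"
      by (auto simp: Bij_def comp_def cong: bij_betw_cong)
    moreover have "?d \<rho> \<in> ring_hom L L"
      by (rule ring_hom_memI) (auto simp: k_mult k_add k_one)
    moreover have "?d \<rho> x = x" if "x \<in> E" for x
      using that E rE[of "h x"] by auto
    ultimately show ?thesis
      by (simp add: carrier_field_Aut)
  qed
  have cd: "?c (?d \<rho>) = \<rho>" if \<rho>: "\<rho> \<in> carrier (field_Aut M F)" for \<rho>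
  proof (rule extensionalityI[of _ "carrier M"])
    show "\<rho> \<in> extensional (carrier M)"
      using \<rho> by (simp add: carrier_field_Aut Bij_def)
    show "?c (?d \<rho>) y = \<rho> y" if "y \<in> carrier M" for y
      using that \<rho> ring_hom_memE(1)[of \<rho> M M y] by (auto simp: carrier_field_Aut)
  qed auto
  have dc: "?d (?c \<sigma>) = \<sigma>" if \<sigma>: "\<sigma> \<in> carrier (field_Aut L E)" for \<sigma>
  proof (rule extensionalityI[of _ "carrier L"])
    show "\<sigma> \<in> extensional (carrier L)"
      using \<sigma> by (simp add: carrier_field_Aut Bij_def)
    show "?d (?c \<sigma>) x = \<sigma> x" if "x \<in> carrier L" for x
      using that \<sigma> ring_hom_memE(1)[of \<sigma> L L x] by (auto simp: carrier_field_Aut)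
  qed auto
  have "?c \<in> hom (field_Aut L E) (field_Aut M F)"
  proof (rule homI)
    fix \<sigma> \<tau> assume s: "\<sigma> \<in> carrier (field_Aut L E)" and t: "\<tau> \<in> carrier (field_Aut L E)"
    have "\<tau> x \<in> carrier L" if "x \<in> carrier L" for x
      using that t ring_hom_memE(1)[of \<tau> L L x] by (auto simp: carrier_field_Aut)
    then show "?c (\<sigma> \<otimes>\<^bsub>field_Aut L E\<^esub> \<tau>) = ?c \<sigma> \<otimes>\<^bsub>field_Aut M F\<^esub> ?c \<tau>"
      by (auto simp: mult_field_Aut[OF s t] mult_field_Aut[OF c[OF s] c[OF t]] compose_def
        fun_eq_iff)
  qed (rule c)
  moreover have "bij_betw ?c (carrier (field_Aut L E)) (carrier (field_Aut M F))"
    by (rule bij_betw_byWitness[where f' = ?d]) (use c d cd dc in auto)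
  ultimately show ?thesis
    by (auto simp: is_iso_def Group.iso_def)
qed

text \<open>Each inclusion goes by induction on the generation of the subfield. Inversion needs its
  own argument, since a ring homomorphism is only known to respect sums and products.\<close>

lemma prime_subfield_ring_iso:
  assumes h: "h \<in> ring_iso L M" and "field L" "field M"
  shows "h ` prime_subfield L = prime_subfield M"
proof -
  interpret L: field L by fact
  interpret M: field M by fact
  have hom: "h \<in> ring_hom L M" and inj: "inj_on h (carrier L)"
    using h by (auto simp: ring_iso_def bij_betw_def)
  interpret h: ring_hom_ring L M h
    by (rule ring_hom_ringI2[OF L.ring_axioms M.ring_axioms hom])
  have cl: "x \<in> carrier L" if "x \<in> generate_field L {}" for x
    using L.generate_field_in_carrier[OF _ that] by simp
  have inv: "h (inv\<^bsub>L\<^esub> x) = inv\<^bsub>M\<^esub> (h x)" "h x \<noteq> \<zero>\<^bsub>M\<^esub>" if "x \<in> carrier L" "x \<noteq> \<zero>\<^bsub>L\<^esub>" for x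
  proof -
    have i: "inv\<^bsub>L\<^esub> x \<in> carrier L" "inv\<^bsub>L\<^esub> x \<otimes>\<^bsub>L\<^esub> x = \<one>\<^bsub>L\<^esub>" "x \<otimes>\<^bsub>L\<^esub> inv\<^bsub>L\<^esub> x = \<one>\<^bsub>L\<^esub>"
      using that L.field_Units by auto
    then have "h x \<otimes>\<^bsub>M\<^esub> h (inv\<^bsub>L\<^esub> x) = \<one>\<^bsub>M\<^esub>" "h (inv\<^bsub>L\<^esub> x) \<otimes>\<^bsub>M\<^esub> h x = \<one>\<^bsub>M\<^esub>"
      using that by (simp_all flip: h.hom_mult)
    then show "h (inv\<^bsub>L\<^esub> x) = inv\<^bsub>M\<^esub> (h x)"
      using i that by (intro M.inv_char[symmetric]) auto
    show "h x \<noteq> \<zero>\<^bsub>M\<^esub>"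
      using inj that h.hom_zero L.zero_closed unfolding inj_on_def by metis
  qed
  have "h x \<in> generate_field M {}" if "x \<in> generate_field L {}" for x
    using that
  proof (induction rule: generate_field.induct)
    case (m_inv x)
    then show ?case using inv[of x] cl by (auto intro: generate_field.m_inv)
  qed (auto simp: cl intro: generate_field.intros)
  moreover have "y \<in> h ` generate_field L {}" if "y \<in> generate_field M {}" for y
    using that
  proof (induction rule: generate_field.induct)
    case one
    show ?case by (rule image_eqI[OF _ generate_field.one]) simp
  next
    case (a_inv y)
    then show ?case
      by (auto simp: cl intro!: image_eqI[OF _ generate_field.a_inv])
  next
    case (m_inv y)
    then obtain x where x: "y = h x" "x \<in> generate_field L {}" by auto
    with m_inv have "x \<noteq> \<zero>\<^bsub>L\<^esub>" by auto
    with x show ?case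
      using inv(1)[of x] cl by (auto intro!: image_eqI[OF _ generate_field.m_inv])
  next
    case (eng_add x y)
    then obtain u v where "x = h u" "u \<in> generate_field L {}" "y = h v" "v \<in> generate_field L {}"
      by auto
    then show ?case
      by (intro image_eqI[of _ _ "u \<oplus>\<^bsub>L\<^esub> v"]) (auto simp: cl intro: generate_field.eng_add)
  next
    case (eng_mult x y)
    then obtain u v where "x = h u" "u \<in> generate_field L {}" "y = h v" "v \<in> generate_field L {}"
      by auto
    then show ?case
      by (intro image_eqI[of _ _ "u \<otimes>\<^bsub>L\<^esub> v"]) (auto simp: cl intro: generate_field.eng_mult)
  qed auto
  ultimately show ?thesis
    unfolding prime_subfield_def by blast
qed

section \<open>From a number field to its computable presentation\<close>

theorem theorem3p7:
  fixes K :: "'a ring" and A :: "nat ring" and C :: "nat set"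
  assumes "number_field K"
    and "computable_presentation A K"
    and "cohesive C"
  shows "field_Aut (cohesive_power C A) (cohesive_power_sub C A (prime_subfield A))
           \<cong> field_Aut K (prime_subfield K)"
proof -
  have A: "field A" "computable_set (carrier A)" "computable_set (atomic_diagram A)"
    using assms(2) by (auto simp: computable_presentation_def computable_field_def)
  obtain h where h: "h \<in> ring_iso A K"
    using assms(2) by (auto simp: computable_presentation_def is_ring_iso_def)
  have K: "field K" "ring.finite_dimension K (prime_subfield K) (carrier K)"
    using assms(1) by (auto simp: number_field_def)
  interpret A: computable_field_arith A
    using A by (intro computable_field_arith.intro computable_field_arith_axioms.intro)
  interpret K: field K by (rule K)
  interpret h: ring_hom_ring A K h
    using h by (intro ring_hom_ringI2[OF A.ring_axioms K.ring_axioms]) (simp add: ring_iso_def)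
  note Q = prime_subfield_ring_iso[OF h A(1) K(1)]
  have inj: "inj_on h (carrier A)" and surj: "h ` carrier A = carrier K"
    using h by (auto simp: ring_iso_def bij_betw_def)
  note sf = A.subfield_prime_subfield
  have "subalgebra (prime_subfield A) (carrier A) A"
    using A.carrier_is_subalgebra A.prime_subfield_closed by auto
  \<comment> \<open>By contraposition: infinite dimension of \<open>A\<close> over its prime
    subfield would pass along the injective \<open>h\<close> to \<open>K\<close>.\<close>
  from h.infinite_dimension_hom[OF sf K.one_not_zero inj this]
  have fd: "A.finite_dimension (prime_subfield A) (carrier A)"
    using K(2) Q surj by auto
  then obtain Us where Us: "set Us \<subseteq> carrier A" "A.Span (prime_subfield A) Us = carrier A"
    using A.exists_base[OF sf] by blast
  interpret number_field_cohesive_power A C Us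
  proof unfold_locales
    show "cohesive C" "set Us \<subseteq> carrier A" by fact+
    fix x assume x: "x \<in> carrier A"
    then have "x \<in> A.Span (prime_subfield A) Us"
      using Us(2) by simp
    then show "\<exists>Ks. set Ks \<subseteq> prime_subfield A \<and> A.combine Ks Us = x"
      unfolding A.Span_eq_combine_set[OF sf Us(1)] by auto
    \<comment> \<open>Finite dimension makes \<open>x\<close> algebraic, which supplies the nonzero
      rational polynomial demanded by \<open>finite_conjugates\<close>.\<close>
    have "(A.algebraic over (prime_subfield A)) x"
      using A.finite_dimension_imp_algebraic[OF sf A.carrier_is_subring fd x] .
    then obtain p where p: "p \<in> carrier ((prime_subfield A)[X]\<^bsub>A\<^esub>)" "p \<noteq> []" "A.eval p x = \<zero>\<^bsub>A\<^esub>"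
      using A.algebraicE[OF subfieldE(1)[OF sf] x] by auto
    then have "polynomial\<^bsub>A\<^esub> (prime_subfield A) p"
      by (simp add: univ_poly_carrier)
    \<comment> \<open>The polynomial is viewed over all of \<open>A\<close>, so that the bound on
      its number of roots covers every root in the field.\<close>
    then have pQ: "set p \<subseteq> prime_subfield A" "polynomial\<^bsub>A\<^esub> (carrier A) p"
      using A.prime_subfield_closed by (auto simp: polynomial_def)
    then have "finite {y. A.is_root p y}"
      by (intro A.finite_number_of_roots) (simp add: univ_poly_carrier)
    with p pQ show "\<exists>p. set p \<subseteq> prime_subfield A \<and> A.eval p x = \<zero>\<^bsub>A\<^esub> \<and>
        finite {y \<in> carrier A. A.eval p y = \<zero>\<^bsub>A\<^esub>}"
      by (intro exI[of _ p]) (auto simp: A.is_root_def)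
  qed
  note field_Aut_cohesive_power
  \<comment> \<open>Conjugation by \<open>h\<close> passes from the presentation to
    \<open>K\<close>, because \<open>h\<close> matches the prime subfields.\<close>
  also have "field_Aut A (prime_subfield A) \<cong> field_Aut K (prime_subfield K)"
    using A.prime_subfield_closed by (intro field_Aut_ring_iso[OF h _ Q A.ring_axioms]) auto
  finally show ?thesis .
qed

end
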